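(* Let $d\ge 3$ be an integer. Local Search is (i) a polynomial time $\left(\frac{9}{16}d+\frac{33}{80}\right)$-factor approximation algorithm for the maximum induced matching problem in $d$-regular $C_4$-free graphs; that is, it runs in polynomial time, and for every $d$-regular $C_4$-free graph $G$, every induced matching $M$ produced by applying Local Search to $G$ satisfies $\nu_s(G)\leq\left(\frac{9}{16}d+\frac{33}{80}\right)|M|$; and (ii) a polynomial time $\left(\frac{d}{2}+\frac{1}{4}+\frac{1}{8d-4}\right)$-factor approximation algorithm for the maximum induced matching problem in $d$-regular $\{C_3,C_4\}$-free graphs; that is, it runs in polynomial time, and for every $d$-regular $\{C_3,C_4\}$-free graph $G$, every induced matching $M$ produced by applying Local Search to $G$ satisfies $\nu_s(G)\leq\left(\frac{d}{2}+\frac{1}{4}+\frac{1}{8d-4}\right)|M|$.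
   Context: Graphs are finite, simple, and undirected; $E(G)$ is the edge set of $G$. A graph is $d$-regular if all its vertices have degree $d$. $C_n$ is the cycle of order $n$; for a set $\mathcal{F}$ of graphs, $G$ is $\mathcal{F}$-free if it contains no graph in $\mathcal{F}$ as an induced subgraph, and $F$-free means $\{F\}$-free. A set $M\subseteq E(G)$ is an induced matching of $G$ if the subgraph of $G$ induced by the set of vertices incident with edges in $M$ is $1$-regular (the empty set is an induced matching). $\nu_s(G)$ is the maximum number of edges of an induced matching of $G$; the maximum induced matching problem asks for an induced matching of this size. Local Search is the following algorithm on input $G$: start with $M=\emptyset$ and repeat the following iteration: (1) if $M\cup\{e\}$ is an induced matching of $G$ for some edge $e\in E(G)\setminus M$, replace $M$ by $M\cup\{e\}$; (2) if $(M\setminus\{e\})\cup\{e',e''\}$ is an induced matching of $G$ for some three distinct edges $e\in M$ and $e',e''\in E(G)\setminus M$, replace $M$ by $(M\setminus\{e\})\cup\{e',e''\}$. The choices are arbitrary. Stop when $|M|$ does not increase during one iteration (i.e. neither (1) nor (2) is possible), and return $M$. *)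

theory Defs
  imports Complex_Main "HOL-Computational_Algebra.Polynomial"
begin

section \<open>Finite simple graphs\<close>

datatype 'a graph = Graph (verts: "'a set") (edges: "'a set set")

definition simple_graph :: "'a graph \<Rightarrow> bool" where
  "simple_graph G \<longleftrightarrow>
     finite (verts G) \<and> (\<forall>e\<in>edges G. e \<subseteq> verts G \<and> card e = 2)"

definition degree_of :: "'a graph \<Rightarrow> 'a \<Rightarrow> nat" where
  "degree_of G v = card {e \<in> edges G. v \<in> e}"

definition regular :: "nat \<Rightarrow> 'a graph \<Rightarrow> bool" where
  "regular d G \<longleftrightarrow> (\<forall>v\<in>verts G. degree_of G v = d)"

definition induced_subgraph :: "'a graph \<Rightarrow> 'a set \<Rightarrow> 'a graph" where
  "induced_subgraph G U = Graph U {e \<in> edges G. e \<subseteq> U}"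

definition isomorphic :: "'a graph \<Rightarrow> 'b graph \<Rightarrow> bool" where
  "isomorphic G H \<longleftrightarrow>
     (\<exists>f. bij_betw f (verts G) (verts H) \<and> (\<lambda>e. f ` e) ` edges G = edges H)"

text \<open>This is the cycle of order \<open>n\<close> for \<open>n \<ge> 3\<close> only.\<close>

definition cycle :: "nat \<Rightarrow> nat graph" where
  "cycle n = Graph {0..<n} {{i, (i + 1) mod n} | i. i < n}"

definition free_of :: "'b graph set \<Rightarrow> 'a graph \<Rightarrow> bool" where
  "free_of \<F> G \<longleftrightarrow>
     (\<forall>U \<subseteq> verts G. \<forall>F\<in>\<F>. \<not> isomorphic (induced_subgraph G U) F)"


section \<open>Induced matchings\<close>

definition induced_matching :: "'a graph \<Rightarrow> 'a set set \<Rightarrow> bool" where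
  "induced_matching G M \<longleftrightarrow> M \<subseteq> edges G \<and> regular 1 (induced_subgraph G (\<Union>M))"

definition nu_s :: "'a graph \<Rightarrow> nat" where
  "nu_s G = Max (card ` {M. induced_matching G M})"


section \<open>Local Search\<close>

definition add_step :: "'a graph \<Rightarrow> 'a set set \<Rightarrow> 'a set set \<Rightarrow> bool" where
  "add_step G M M' \<longleftrightarrow>
     (let C = {M \<union> {e} | e. e \<in> edges G - M \<and> induced_matching G (M \<union> {e})}
      in if C = {} then M' = M else M' \<in> C)"

definition swap_step :: "'a graph \<Rightarrow> 'a set set \<Rightarrow> 'a set set \<Rightarrow> bool" where
  "swap_step G M M' \<longleftrightarrow>
     (let C = {(M - {e}) \<union> {e', e''} | e e' e''.
                 e \<in> M \<and> e' \<in> edges G - M \<and> e'' \<in> edges G - M \<and> e' \<noteq> e'' \<and>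
                 induced_matching G ((M - {e}) \<union> {e', e''})}
      in if C = {} then M' = M else M' \<in> C)"

definition iteration :: "'a graph \<Rightarrow> 'a set set \<Rightarrow> 'a set set \<Rightarrow> bool" where
  "iteration G = add_step G OO swap_step G"

text \<open>
  \<open>ls_run G M Ms\<close>: starting from \<open>M\<close>, Local Search can go through the sets \<open>Ms\<close>
  (one entry for each iteration performed) and then stop, returning \<open>last Ms\<close>.
\<close>

inductive ls_run :: "'a graph \<Rightarrow> 'a set set \<Rightarrow> 'a set set list \<Rightarrow> bool" for G where
  stop: "iteration G M M' \<Longrightarrow> \<not> card M < card M' \<Longrightarrow> ls_run G M [M']"
| continue: "iteration G M M' \<Longrightarrow> card M < card M' \<Longrightarrow> ls_run G M' Ms \<Longrightarrow> ls_run G M (M' # Ms)"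

definition local_search_output :: "'a graph \<Rightarrow> 'a set set \<Rightarrow> bool" where
  "local_search_output G M \<longleftrightarrow> (\<exists>Ms. ls_run G {} Ms \<and> M = last Ms)"


section \<open>Machine model\<close>

text \<open>
  Running time is measured in a structured successor RAM: unbounded scalar variables and
  arrays over the natural numbers, with successor as the only arithmetic operation. Numbers
  therefore grow by at most a constant (depending on the program) in each step, and so the
  unit-cost measure agrees with Turing machine time up to a polynomial. The command \<open>Or\<close>
  makes an arbitrary choice; a program without \<open>Or\<close> is deterministic.
\<close>

type_synonym name = string

datatype exp = Const nat | Var name | Elem name exp | Succ exp

datatype cond = Less exp exp | Negate cond | Both cond cond

datatype com =
    Skip
  | Assign name exp
  | Store name exp exp
  | Print exp
  | Seq com com
  | Branch cond com com
  | While cond com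
  | Or com com

record state =
  vars :: "name \<Rightarrow> nat"
  arrays :: "name \<Rightarrow> nat \<Rightarrow> nat"
  printed :: "nat list"

primrec exp_val :: "exp \<Rightarrow> state \<Rightarrow> nat" where
  "exp_val (Const k) s = k"
| "exp_val (Var x) s = vars s x"
| "exp_val (Elem a i) s = arrays s a (exp_val i s)"
| "exp_val (Succ e) s = Suc (exp_val e s)"

primrec cond_val :: "cond \<Rightarrow> state \<Rightarrow> bool" where
  "cond_val (Less e f) s \<longleftrightarrow> exp_val e s < exp_val f s"
| "cond_val (Negate b) s \<longleftrightarrow> \<not> cond_val b s"
| "cond_val (Both b c) s \<longleftrightarrow> cond_val b s \<and> cond_val c s"

inductive step :: "com \<times> state \<Rightarrow> com \<times> state \<Rightarrow> bool" where
  "step (Assign x e, s) (Skip, s\<lparr>vars := (vars s)(x := exp_val e s)\<rparr>)"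
| "step (Store a i e, s)
     (Skip, s\<lparr>arrays := (arrays s)(a := (arrays s a)(exp_val i s := exp_val e s))\<rparr>)"
| "step (Print e, s) (Skip, s\<lparr>printed := printed s @ [exp_val e s]\<rparr>)"
| "step (Seq Skip c, s) (c, s)"
| "step (c, s) (c', s') \<Longrightarrow> step (Seq c c2, s) (Seq c' c2, s')"
| "cond_val b s \<Longrightarrow> step (Branch b c1 c2, s) (c1, s)"
| "\<not> cond_val b s \<Longrightarrow> step (Branch b c1 c2, s) (c2, s)"
| "step (While b c, s) (Branch b (Seq c (While b c)) Skip, s)"
| "step (Or c1 c2, s) (c1, s)"
| "step (Or c1 c2, s) (c2, s)"

text \<open>Every execution halts, whatever the choices, after at most \<open>t\<close> steps.\<close>

definition halts_within :: "com \<Rightarrow> state \<Rightarrow> nat \<Rightarrow> bool" where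
  "halts_within c s t \<longleftrightarrow> (\<forall>k cfg. (step ^^ k) (c, s) cfg \<longrightarrow> k \<le> t)"

definition outputs :: "com \<Rightarrow> state \<Rightarrow> nat list set" where
  "outputs c s = {printed s' | s'. step\<^sup>*\<^sup>* (c, s) (Skip, s')}"


section \<open>Polynomial running time of Local Search\<close>

text \<open>
  A graph is given to a program by an enumeration \<open>vs\<close> of its vertices and a list \<open>es\<close> of its
  edges as pairs of positions in \<open>vs\<close>; order and orientation are arbitrary.
\<close>

definition edge_list :: "'a list \<Rightarrow> (nat \<times> nat) list \<Rightarrow> 'a set list" where
  "edge_list vs es = map (\<lambda>(i, j). {vs ! i, vs ! j}) es"

definition encodes :: "'a list \<Rightarrow> (nat \<times> nat) list \<Rightarrow> 'a graph \<Rightarrow> bool" where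
  "encodes vs es G \<longleftrightarrow>
     distinct vs \<and> set vs = verts G \<and>
     (\<forall>(i, j)\<in>set es. i < length vs \<and> j < length vs) \<and>
     distinct (edge_list vs es) \<and> set (edge_list vs es) = edges G"

definition input_state :: "'a list \<Rightarrow> (nat \<times> nat) list \<Rightarrow> state" where
  "input_state vs es =
     \<lparr>vars = (\<lambda>_. 0)(''n'' := length vs, ''m'' := length es),
      arrays = (\<lambda>_ _. 0)
        (''src'' := (\<lambda>k. if k < length es then fst (es ! k) else 0),
         ''tgt'' := (\<lambda>k. if k < length es then snd (es ! k) else 0)),
      printed = []\<rparr>"

definition transcript :: "'a set list \<Rightarrow> 'a set set list \<Rightarrow> nat list" where
  "transcript el Ms = concat (map (\<lambda>M. map (\<lambda>e. if e \<in> M then 1 else 0) el) Ms)"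

text \<open>
  Some program carries out Local Search in polynomial time on the graphs in \<open>\<G>\<close>. It prints
  the 0/1 vector of the current set \<open>M\<close> after each iteration, the last one being the set
  returned, and its possible transcripts are exactly those of the runs of Local Search. So the
  bound covers every way of making the choices, and always taking the left operand of \<open>Or\<close>
  gives a deterministic polynomial time implementation.
\<close>

definition local_search_poly_time :: "'a graph set \<Rightarrow> bool" where
  "local_search_poly_time \<G> \<longleftrightarrow>
     (\<exists>(c :: com) (p :: nat poly). \<forall>G\<in>\<G>. \<forall>vs es. encodes vs es G \<longrightarrow>
        halts_within c (input_state vs es) (poly p (length vs + length es)) \<and>
        outputs c (input_state vs es) = {transcript (edge_list vs es) Ms | Ms. ls_run G {} Ms})"

definition local_search_approximates :: "real \<Rightarrow> 'a graph set \<Rightarrow> bool" where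
  "local_search_approximates \<alpha> \<G> \<longleftrightarrow>
     (\<forall>G\<in>\<G>. \<forall>M. local_search_output G M \<longrightarrow>
        induced_matching G M \<and> real (nu_s G) \<le> \<alpha> * real (card M))"

end

theory Submission
  imports Defs
begin

text \<open>
  The theorem has a combinatorial part, the two approximation factors, and an algorithmic part,
  a program for Local Search that makes every choice the algorithm allows and halts in
  polynomial time.

  For the factors, say that two edges conflict if some edge meets both; an induced
  matching is a set of pairwise non-conflicting edges. In a \<open>d\<close>-regular graph each edge is met by
  \<open>2d - 1\<close> edges, and no edge meets two members of an induced matching, so
  \<open>\<nu>\<^sub>s (2d - 1) \<le> |E|\<close> (\<open>nu_s_le\<close>). It remains to bound \<open>|E|\<close> by a multiple of \<open>|M|\<close>, where \<open>M\<close> is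
  the set returned. Call an edge private to \<open>e \<in> M\<close> if \<open>e\<close> is the only member of \<open>M\<close> in conflict
  with it. No edge can be added to \<open>M\<close>, so every edge conflicts with some member of \<open>M\<close>, with at
  least two of them unless it is private, and double counting gives
  \<open>2|E| \<le> \<Sum>\<^sub>e\<^sub>\<in>\<^sub>M (conflicts of e + private edges of e)\<close> (\<open>two_card_edges_le\<close>).
  The two factors correspond to the bounds \<open>9/4 d\<^sup>2 + 21/40 d - 33/40\<close> and \<open>2d\<^sup>2\<close> for one summand.

  Let \<open>e = {u, v}\<close>, and let \<open>F\<close> be the set of vertices out of reach of the other members of \<open>M\<close>; the
  private edges of \<open>e\<close> are the edges inside \<open>F\<close>. No swap is possible, so they pairwise conflict.
  No edge inside \<open>F\<close> avoids \<open>N(u) \<union> N(v)\<close>, since it could be added to \<open>M\<close>. So the far vertices, those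
  of \<open>F\<close> outside \<open>N(u) \<union> N(v)\<close>, are independent. Counting degrees over \<open>N(u) \<union> N(v)\<close> shows
  (\<open>card_conflict_private\<close>) that the summand is at most \<open>2d\<^sup>2\<close>, plus the number of edges between the
  far vertices and the two sides \<open>N(u) - N[v]\<close> and \<open>N(v) - N[u]\<close> of \<open>e\<close>, minus the number of vertices
  of the sides that lie outside \<open>F\<close>: the edges inside \<open>N(u) \<union> N(v)\<close> and the common neighbours of \<open>u\<close>
  and \<open>v\<close> pay for all private edges at them.

  Without induced \<open>C\<^sub>4\<close>, the \<open>t\<close> vertices of \<open>F\<close> on one side that have far neighbours form a clique, as
  two non-adjacent ones would give non-conflicting private edges or a \<open>C\<^sub>4\<close> through \<open>u\<close>
  (\<open>linked_clique\<close>). So they send at most \<open>t (d - t)\<close> edges to far vertices. Moreover every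
  vertex of \<open>F\<close> on the other side is adjacent to all far vertices so reached
  (\<open>far_link_dominates\<close>). Hence if only one side has far neighbours, the other side lies outside \<open>F\<close>,
  which together with the common neighbours gains \<open>d - 1\<close>; and if both have, then they all reach
  the same single far vertex, so there are at most \<open>d\<close> such edges. Since \<open>t (d - t) \<le> d\<^sup>2/4\<close>, the first bound follows with room to
  spare; without triangles cliques on a side have one vertex, and \<open>2d\<^sup>2\<close> follows.

  For the running time, both steps of an iteration pass from \<open>M\<close> to \<open>M - {a} \<union> {b, c}\<close> for a triple of edges,
  with \<open>a = b = c \<notin> M\<close> for an addition. The program runs through all triples, stores
  those whose result is an induced matching, and then walks along the stored list
  nondeterministically, stopping anywhere. This confines the nondeterminism to a tiny loop.
  Reaching every transcript needs some execution and halting needs all executions;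
  the judgement \<open>ensures\<close> treats both readings at once, so that the deterministic code is verified a
  single time (\<open>ensures_search\<close>).
\<close>

section \<open>Induced matchings and the iterations of Local Search\<close>

locale graph =
  fixes G :: "'a graph"
  assumes simple: "simple_graph G"
begin

definition adj :: "'a \<Rightarrow> 'a \<Rightarrow> bool" where
  "adj x y \<longleftrightarrow> {x, y} \<in> edges G"

definition nbrs :: "'a \<Rightarrow> 'a set" where
  "nbrs x = {y. adj x y}"

lemma finite_verts: "finite (verts G)"
  using simple by (simp add: simple_graph_def)

lemma finite_edges: "finite (edges G)"
proof (rule finite_subset)
  show "edges G \<subseteq> Pow (verts G)" using simple by (auto simp: simple_graph_def)
qed (simp add: finite_verts)

lemma adj_sym: "adj x y \<Longrightarrow> adj y x"
  by (simp add: adj_def insert_commute)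

lemma adj_irrefl: "\<not> adj x x"
  using simple by (force simp: adj_def simple_graph_def)

lemma adj_verts: "adj x y \<Longrightarrow> x \<in> verts G"
  using simple by (auto simp: adj_def simple_graph_def)

lemma edge_cases:
  assumes "e \<in> edges G"
  obtains x y where "e = {x, y}" "adj x y" "x \<noteq> y"
proof -
  have "card e = 2" using assms simple by (simp add: simple_graph_def)
  then obtain x y where "e = {x, y}" "x \<noteq> y" by (auto simp: card_2_iff)
  then show ?thesis using that assms by (simp add: adj_def)
qed

lemma edge_through:
  assumes "e \<in> edges G" "x \<in> e"
  obtains y where "e = {x, y}" "adj x y"
  using assms edge_cases[OF assms(1)] adj_sym by (metis insert_iff insert_commute singletonD)

lemma finite_nbrs: "finite (nbrs x)"
  by (rule finite_subset[OF _ finite_verts]) (auto simp: nbrs_def dest: adj_sym adj_verts)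

text \<open>
  The form in which the program tests a set. Taking \<open>h = e\<close> shows that distinct members are disjoint,
  and any other \<open>h\<close> that no edge of the graph joins two of them.
\<close>

lemma induced_matching_iff:
  "induced_matching G X \<longleftrightarrow> X \<subseteq> edges G \<and>
    (\<forall>e\<in>X. \<forall>f\<in>X. \<forall>h\<in>edges G. h \<inter> e \<noteq> {} \<longrightarrow> h \<inter> f \<noteq> {} \<longrightarrow> e = f)"
proof (cases "X \<subseteq> edges G")
  case True
  let ?E = "\<lambda>v. {e \<in> edges G. e \<subseteq> \<Union>X \<and> v \<in> e}"
  have "induced_matching G X \<longleftrightarrow> (\<forall>v\<in>\<Union>X. card (?E v) = 1)"
    using True by (simp add: induced_matching_def regular_def induced_subgraph_def degree_of_def conj_assoc)
  also have "\<dots> \<longleftrightarrow> (\<forall>e\<in>X. \<forall>f\<in>X. \<forall>h\<in>edges G. h \<inter> e \<noteq> {} \<longrightarrow> h \<inter> f \<noteq> {} \<longrightarrow> e = f)"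
    (is "?L \<longleftrightarrow> ?R")
  proof
    assume L: ?L
    have uniq: "e = f" if "v \<in> \<Union>X" "e \<in> ?E v" "f \<in> ?E v" for v e f
    proof -
      have "card (?E v) = 1" using L that(1) by blast
      then obtain g where "?E v = {g}" by (rule card_1_singletonE)
      then have "e \<in> {g}" "f \<in> {g}" using that(2,3) by (simp_all only:)
      then show ?thesis by simp
    qed
    show ?R
    proof (intro ballI impI)
      fix e f h assume e: "e \<in> X" and f: "f \<in> X" and h: "h \<in> edges G" "h \<inter> e \<noteq> {}" "h \<inter> f \<noteq> {}"
      then obtain x y where xy: "x \<in> h" "x \<in> e" "y \<in> h" "y \<in> f" by blast
      show "e = f"
      proof (cases "x = y")
        case True
        then show ?thesis using uniq[of x e f] xy e f \<open>X \<subseteq> edges G\<close> by blast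
      next
        case False
        moreover have "card h = 2" using simple h by (simp add: simple_graph_def)
        ultimately have "h = {x, y}" using xy by (auto simp: card_2_iff)
        then have "h \<subseteq> \<Union>X" using xy e f by blast
        then have "h = e" "h = f"
          using uniq[of x h e] uniq[of y h f] xy e f h \<open>X \<subseteq> edges G\<close> by blast+
        then show ?thesis by simp
      qed
    qed
  next
    assume R: ?R
    show ?L
    proof
      fix v assume "v \<in> \<Union>X"
      then obtain e where e: "e \<in> X" "v \<in> e" by blast
      have "g = e" if g: "g \<in> edges G" "g \<subseteq> \<Union>X" "v \<in> g" for g
      proof -
        have "card g = 2" "card e = 2" using simple g e True by (auto simp: simple_graph_def)
        moreover have "g \<subseteq> e"
        proof
          fix w assume w: "w \<in> g"
          then obtain f where f: "f \<in> X" "w \<in> f" using g by blast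
          then have "e = f" using R e g w by blast
          then show "w \<in> e" using f by simp
        qed
        ultimately show ?thesis
          by (metis card_2_iff card_subset_eq finite.emptyI finite.insertI)
      qed
      then have "?E v = {e}" using e True by blast
      then show "card (?E v) = 1" by simp
    qed
  qed
  finally show ?thesis using True by simp
qed (simp add: induced_matching_def)

text \<open>
  What Local Search guarantees about the set it returns, and all that the approximation factors need.
\<close>

definition locally_optimal :: "'a set set \<Rightarrow> bool" where
  "locally_optimal M \<longleftrightarrow> induced_matching G M \<and>
     (\<forall>f\<in>edges G - M. \<not> induced_matching G (M \<union> {f})) \<and>
     (\<forall>e\<in>M. \<forall>f\<in>edges G - M. \<forall>f'\<in>edges G - M. f \<noteq> f' \<longrightarrow>
        \<not> induced_matching G ((M - {e}) \<union> {f, f'}))"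

lemma add_step_cases:
  assumes "add_step G S S'"
  obtains "S' = S" "\<forall>f\<in>edges G - S. \<not> induced_matching G (S \<union> {f})"
  | f where "f \<notin> S" "S' = S \<union> {f}" "induced_matching G S'"
  using assms by (auto simp: add_step_def Let_def split: if_splits)

lemma swap_step_cases:
  assumes "swap_step G S S'"
  obtains "S' = S" "\<forall>e\<in>S. \<forall>f\<in>edges G - S. \<forall>f'\<in>edges G - S. f \<noteq> f' \<longrightarrow>
        \<not> induced_matching G ((S - {e}) \<union> {f, f'})"
  | e f f' where "e \<in> S" "f \<notin> S" "f' \<notin> S" "f \<noteq> f'" "S' = (S - {e}) \<union> {f, f'}" "induced_matching G S'"
proof -
  define C where "C = {(S - {e}) \<union> {e', e''} | e e' e''.
                 e \<in> S \<and> e' \<in> edges G - S \<and> e'' \<in> edges G - S \<and> e' \<noteq> e'' \<and>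
                 induced_matching G ((S - {e}) \<union> {e', e''})}"
  have *: "if C = {} then S' = S else S' \<in> C" using assms unfolding swap_step_def Let_def C_def .
  show ?thesis
  proof (cases "C = {}")
    case True
    then have "S' = S" using * by simp
    moreover have "\<forall>e\<in>S. \<forall>f\<in>edges G - S. \<forall>f'\<in>edges G - S. f \<noteq> f' \<longrightarrow>
        \<not> induced_matching G ((S - {e}) \<union> {f, f'})" using True unfolding C_def by blast
    ultimately show ?thesis using that(1) by blast
  next
    case False
    then have "S' \<in> C" using * by simp
    then show ?thesis using that(2) unfolding C_def by blast
  qed
qed

lemma induced_matching_finite: "induced_matching G S \<Longrightarrow> finite S"
  using finite_edges finite_subset by (auto simp: induced_matching_def)

lemma card_remove_insert2:
  assumes "finite S" "e \<in> S" "f \<notin> S" "f' \<notin> S" "f \<noteq> f'"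
  shows "card ((S - {e}) \<union> {f, f'}) = Suc (card S)"
proof -
  have "(S - {e}) \<union> {f, f'} = insert f (insert f' (S - {e}))" by auto
  moreover have "Suc (card (S - {e})) = card S" using assms(1,2) by (rule card_Suc_Diff1)
  ultimately show ?thesis using assms by simp
qed

text \<open>
  Each effective step adds exactly one to the size, so an iteration without gain has performed
  neither step.
\<close>

lemma iteration_induced_matching:
  assumes S: "induced_matching G S" and it: "iteration G S S'"
  shows "induced_matching G S'" "\<not> card S < card S' \<Longrightarrow> locally_optimal S'"
proof -
  obtain S1 where add: "add_step G S S1" and swap: "swap_step G S1 S'"
    using it by (auto simp: iteration_def)
  have S1: "induced_matching G S1" using add S by (cases rule: add_step_cases) auto
  show S': "induced_matching G S'" using swap S1 by (cases rule: swap_step_cases) auto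
  show "locally_optimal S'" if stop: "\<not> card S < card S'"
  proof -
    have le: "card S1 \<le> card S'"
      using swap card_remove_insert2[OF induced_matching_finite[OF S1]] by (cases rule: swap_step_cases) auto
    have "S1 = S \<and> (\<forall>f\<in>edges G - S. \<not> induced_matching G (S \<union> {f}))"
      using add
    proof (cases rule: add_step_cases)
      case (2 f)
      then have "card S1 = Suc (card S)" using induced_matching_finite[OF S] by simp
      then show ?thesis using le stop by simp
    qed simp
    moreover have "S' = S1 \<and> (\<forall>e\<in>S1. \<forall>f\<in>edges G - S1. \<forall>f'\<in>edges G - S1. f \<noteq> f' \<longrightarrow>
        \<not> induced_matching G ((S1 - {e}) \<union> {f, f'}))"
      using swap
    proof (cases rule: swap_step_cases)
      case (2 e f f')
      then have "card S' = Suc (card S1)" using card_remove_insert2[OF induced_matching_finite[OF S1]] by simp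
      then show ?thesis using calculation stop by simp
    qed simp
    ultimately show ?thesis using S' unfolding locally_optimal_def by simp
  qed
qed

lemma ls_run_locally_optimal:
  assumes "ls_run G S Ms" "induced_matching G S"
  shows "Ms \<noteq> [] \<and> locally_optimal (last Ms)"
  using assms
proof induction
  case (stop M M')
  then show ?case using iteration_induced_matching[OF stop(3,1)] by simp
next
  case (continue M M' Ms)
  then show ?case using iteration_induced_matching[OF continue(5,1)] by simp
qed

lemma local_search_output_locally_optimal: "local_search_output G M \<Longrightarrow> locally_optimal M"
  using ls_run_locally_optimal[of "{}"] induced_matching_iff[of "{}"]
  by (auto simp: local_search_output_def)

end

section \<open>A timed calculus for programs\<close>

text \<open>
  The executions of \<open>c\<close> from \<open>s\<close> end within \<open>t\<close> steps in a state satisfying \<open>Q\<close>: all of them if the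
  choices are demonic (\<open>ang\<close> is false), at least one if they are angelic. Only
  \<open>Or\<close> creates several successors, so all other rules have the same form for both readings.
\<close>

primrec ensures :: "bool \<Rightarrow> nat \<Rightarrow> com \<Rightarrow> state \<Rightarrow> (state \<Rightarrow> bool) \<Rightarrow> bool" where
  "ensures ang 0 c s Q \<longleftrightarrow> c = Skip \<and> Q s"
| "ensures ang (Suc t) c s Q \<longleftrightarrow>
     (if c = Skip then Q s
      else if ang then \<exists>c' s'. step (c, s) (c', s') \<and> ensures ang t c' s' Q
      else \<forall>c' s'. step (c, s) (c', s') \<longrightarrow> ensures ang t c' s' Q)"

inductive_cases step_SkipE: "step (Skip, s) cfg"
inductive_cases step_AssignE: "step (Assign x e, s) cfg"
inductive_cases step_StoreE: "step (Store a i e, s) cfg"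
inductive_cases step_PrintE: "step (Print e, s) cfg"
inductive_cases step_SeqE: "step (Seq c1 c2, s) cfg"
inductive_cases step_BranchE: "step (Branch b c1 c2, s) cfg"
inductive_cases step_WhileE: "step (While b c, s) cfg"
inductive_cases step_OrE: "step (Or c1 c2, s) cfg"

lemma ensures_Skip: "Q s \<Longrightarrow> ensures ang t Skip s Q"
  by (cases t) auto

lemma ensures_mono:
  assumes "ensures ang t c s Q" "t \<le> t'" "\<And>s'. Q s' \<Longrightarrow> Q' s'"
  shows "ensures ang t' c s Q'"
  using assms(1,2)
proof (induction t arbitrary: t' c s)
  case 0
  then show ?case using assms(3) by (auto intro: ensures_Skip)
next
  case (Suc t)
  then obtain t'' where "t' = Suc t''" "t \<le> t''" by (cases t') auto
  then show ?case using Suc assms(3) by (auto split: if_splits) blast+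
qed

lemma ensures_step:
  assumes "c \<noteq> Skip" "\<And>cfg. step (c, s) cfg \<longleftrightarrow> cfg = (c', s')" "ensures ang t c' s' Q"
  shows "ensures ang (Suc t) c s Q"
  using assms by auto

lemma ensures_Assign:
  "Q (s\<lparr>vars := (vars s)(x := exp_val e s)\<rparr>) \<Longrightarrow> 0 < t \<Longrightarrow> ensures ang t (Assign x e) s Q"
  by (cases t) (auto elim: step_AssignE intro: step.intros ensures_Skip)

lemma ensures_Store:
  "Q (s\<lparr>arrays := (arrays s)(a := (arrays s a)(exp_val i s := exp_val e s))\<rparr>) \<Longrightarrow>
   0 < t \<Longrightarrow> ensures ang t (Store a i e) s Q"
  by (cases t) (auto elim: step_StoreE intro: step.intros ensures_Skip)

lemma ensures_Print:
  "Q (s\<lparr>printed := printed s @ [exp_val e s]\<rparr>) \<Longrightarrow> 0 < t \<Longrightarrow> ensures ang t (Print e) s Q"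
  by (cases t) (auto elim: step_PrintE intro: step.intros ensures_Skip)

lemma step_Seq_iff:
  "step (Seq c1 c2, s) (c', s') \<longleftrightarrow>
     c1 = Skip \<and> c' = c2 \<and> s' = s \<or> (\<exists>c1'. step (c1, s) (c1', s') \<and> c' = Seq c1' c2)"
  by (auto elim: step_SeqE intro: step.intros)

lemma ensures_Seq:
  assumes "ensures ang t1 c1 s (\<lambda>s1. ensures ang t2 c2 s1 Q)"
  shows "ensures ang (t1 + t2 + 1) (Seq c1 c2) s Q"
  using assms
proof (induction t1 arbitrary: c1 s)
  case 0
  then have "ensures ang t2 c2 s Q" by simp
  then have "ensures ang (Suc t2) (Seq Skip c2) s Q"
    by (intro ensures_step[where c' = c2 and s' = s])
      (auto elim: step_SeqE step_SkipE intro: step.intros)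
  moreover have "c1 = Skip" using 0 by simp
  ultimately show ?case by (simp only: add_0 Suc_eq_plus1)
next
  case (Suc t1)
  show ?case
  proof (cases "c1 = Skip")
    case True
    then have "ensures ang t2 c2 s Q" using Suc by simp
    then have "ensures ang (Suc t1 + t2) c2 s Q" by (rule ensures_mono) auto
    then have "ensures ang (Suc (Suc t1 + t2)) (Seq Skip c2) s Q"
      by (intro ensures_step[where c' = c2 and s' = s])
        (auto elim: step_SeqE step_SkipE intro: step.intros)
    then show ?thesis unfolding True by (rule ensures_mono) auto
  next
    case False
    with Suc.prems have "if ang
      then \<exists>c' s'. step (c1, s) (c', s') \<and> ensures ang t1 c' s' (\<lambda>s1. ensures ang t2 c2 s1 Q)
      else \<forall>c' s'. step (c1, s) (c', s') \<longrightarrow> ensures ang t1 c' s' (\<lambda>s1. ensures ang t2 c2 s1 Q)"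
      by simp
    then have "if ang
      then \<exists>c' s'. step (Seq c1 c2, s) (c', s') \<and> ensures ang (t1 + t2 + 1) c' s' Q
      else \<forall>c' s'. step (Seq c1 c2, s) (c', s') \<longrightarrow> ensures ang (t1 + t2 + 1) c' s' Q"
      using Suc.IH False unfolding step_Seq_iff by (cases ang) (simp, blast)+
    then have "ensures ang (Suc (t1 + t2 + 1)) (Seq c1 c2) s Q"
      unfolding ensures.simps(2) by simp
    then show ?thesis by (simp only: add_Suc)
  qed
qed

lemma ensures_Branch:
  assumes "cond_val b s \<Longrightarrow> ensures ang t c1 s Q" "\<not> cond_val b s \<Longrightarrow> ensures ang t c2 s Q"
  shows "ensures ang (t + 1) (Branch b c1 c2) s Q"
proof -
  have "step (Branch b c1 c2, s) cfg \<longleftrightarrow> cfg = (if cond_val b s then c1 else c2, s)" for cfg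
    by (auto elim: step_BranchE intro: step.intros)
  from ensures_step[OF _ this] show ?thesis using assms by auto
qed

lemma ensures_While:
  assumes "cond_val b s \<Longrightarrow> ensures ang t (Seq c (While b c)) s Q"
    "\<not> cond_val b s \<Longrightarrow> Q s"
  shows "ensures ang (t + 2) (While b c) s Q"
proof -
  have "step (While b c, s) cfg \<longleftrightarrow> cfg = (Branch b (Seq c (While b c)) Skip, s)" for cfg
    by (auto elim: step_WhileE intro: step.intros)
  moreover have "ensures ang (t + 1) (Branch b (Seq c (While b c)) Skip) s Q"
    using assms by (intro ensures_Branch ensures_Skip)
  ultimately have "ensures ang (Suc (t + 1)) (While b c) s Q"
    using ensures_step[of "While b c" s "Branch b (Seq c (While b c)) Skip" s ang "t + 1" Q]
    by (simp del: ensures.simps)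
  then show ?thesis by (simp only: add_Suc_right[symmetric] Suc_1[symmetric] One_nat_def)
qed

lemma ensures_Or:
  assumes "if ang then ensures ang t c1 s Q \<or> ensures ang t c2 s Q
    else ensures ang t c1 s Q \<and> ensures ang t c2 s Q"
  shows "ensures ang (t + 1) (Or c1 c2) s Q"
proof -
  have "step (Or c1 c2, s) cfg \<longleftrightarrow> cfg = (c1, s) \<or> cfg = (c2, s)" for cfg
    by (auto elim: step_OrE intro: step.intros)
  then show ?thesis using assms by (cases ang) (simp_all, blast+)
qed

lemma ensures_demonic_halts:
  assumes "ensures False t c s Q"
  shows "halts_within c s t"
proof -
  have "k \<le> t" if "(step ^^ k) (c, s) cfg" for k cfg
    using assms that
  proof (induction t arbitrary: k c s)
    case 0
    then show ?case by (cases k) (auto simp: relpowp_Suc_left relcompp_apply elim: step_SkipE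
          simp del: relpowp.simps)
  next
    case (Suc t)
    show ?case
    proof (cases k)
      case (Suc k')
      then obtain c' s' where st: "step (c, s) (c', s')" and k': "(step ^^ k') (c', s') cfg"
        using Suc.prems(2) by (auto simp: relpowp_Suc_left relcompp_apply simp del: relpowp.simps)
      then have "c \<noteq> Skip" by (auto elim: step_SkipE)
      then have "ensures False t c' s' Q" using Suc.prems(1) st by auto
      then show ?thesis using Suc.IH k' Suc by auto
    qed simp
  qed
  then show ?thesis by (auto simp: halts_within_def)
qed

lemma ensures_demonic_final:
  assumes "ensures False t c s Q" "step\<^sup>*\<^sup>* (c, s) (Skip, s')"
  shows "Q s'"
  using assms
proof (induction t arbitrary: c s)
  case 0
  then show ?case by (auto elim: converse_rtranclpE step_SkipE)
next
  case (Suc t)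
  show ?case
  proof (cases "c = Skip")
    case True
    then show ?thesis using Suc.prems by (auto elim: converse_rtranclpE step_SkipE)
  next
    case False
    then obtain c1 s1 where "step (c, s) (c1, s1)" "step\<^sup>*\<^sup>* (c1, s1) (Skip, s')"
      using Suc.prems(2) by (auto elim: converse_rtranclpE)
    then show ?thesis using Suc False by auto
  qed
qed

lemma ensures_angelic_final:
  assumes "ensures True t c s Q"
  shows "\<exists>s'. step\<^sup>*\<^sup>* (c, s) (Skip, s') \<and> Q s'"
  using assms
proof (induction t arbitrary: c s)
  case 0
  then show ?case by auto
next
  case (Suc t)
  show ?case
  proof (cases "c = Skip")
    case False
    then obtain c' s' where "step (c, s) (c', s')" "ensures True t c' s' Q"
      using Suc.prems by auto
    then show ?thesis using Suc.IH by (meson converse_rtranclp_into_rtranclp)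
  qed (use Suc.prems in auto)
qed

declare ensures.simps [simp del]

definition frame :: "name set \<Rightarrow> name set \<Rightarrow> state \<Rightarrow> state \<Rightarrow> bool" where
  "frame X A s s' \<longleftrightarrow> (\<forall>x. x \<notin> X \<longrightarrow> vars s' x = vars s x) \<and>
     (\<forall>a. a \<notin> A \<longrightarrow> arrays s' a = arrays s a) \<and> printed s' = printed s"

lemma frame_trans: "frame X A s s' \<Longrightarrow> frame X' A' s' s'' \<Longrightarrow> X \<subseteq> Y \<Longrightarrow> X' \<subseteq> Y \<Longrightarrow> A \<subseteq> B \<Longrightarrow> A' \<subseteq> B
   \<Longrightarrow> frame Y B s s''"
  unfolding frame_def by (metis subsetD)

lemma frame_vars: "frame X A s s' \<Longrightarrow> x \<notin> X \<Longrightarrow> vars s' x = vars s x"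
  by (simp add: frame_def)

lemma frame_arrays: "frame X A s s' \<Longrightarrow> a \<notin> A \<Longrightarrow> arrays s' a = arrays s a"
  by (simp add: frame_def)

lemma frame_printed: "frame X A s s' \<Longrightarrow> printed s' = printed s"
  by (simp add: frame_def)

lemma frame_refl: "frame X A s s"
  by (simp add: frame_def)

lemma frame_assign: "x \<in> X \<Longrightarrow> frame X A s s' \<Longrightarrow> frame X A s (s'\<lparr>vars := (vars s')(x := v)\<rparr>)"
  by (auto simp: frame_def)

definition For :: "name \<Rightarrow> com \<Rightarrow> com" where
  "For x c = Seq (Assign x (Const 0))
     (While (Less (Var x) (Var ''m'')) (Seq c (Assign x (Succ (Var x)))))"

text \<open>
  The time bound uses an upper bound \<open>L\<close> of the number \<open>m\<close> of rounds, so that the bounds of nested loops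
  are expressions in \<open>L\<close> alone and do not depend on the state.
\<close>

lemma ensures_For:
  assumes init: "I 0 (s\<lparr>vars := (vars s)(x := 0)\<rparr>)"
    and m: "vars s ''m'' = m" "m \<le> L" and x: "x \<noteq> ''m''"
    and body: "\<And>i s1. i < m \<Longrightarrow> I i s1 \<Longrightarrow> vars s1 x = i \<Longrightarrow> vars s1 ''m'' = m \<Longrightarrow>
       ensures ang t c s1 (\<lambda>s2. vars s2 x = i \<and> vars s2 ''m'' = m \<and>
          I (Suc i) (s2\<lparr>vars := (vars s2)(x := Suc i)\<rparr>))"
    and fin: "\<And>s'. I m s' \<Longrightarrow> Q s'"
  shows "ensures ang (L * (t + 5) + 4) (For x c) s Q"
proof -
  let ?W = "While (Less (Var x) (Var ''m'')) (Seq c (Assign x (Succ (Var x))))"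
  have W: "ensures ang ((m - i) * (t + 5) + 2) ?W s1 Q"
    if "i \<le> m" "I i s1" "vars s1 x = i" "vars s1 ''m'' = m" for i s1
    using that
  proof (induction "m - i" arbitrary: i s1)
    case 0
    then show ?case using fin by (intro ensures_While) auto
  next
    case (Suc k)
    then have i: "i < m" "k = m - Suc i" by auto
    have "ensures ang (t + 1 + 1) (Seq c (Assign x (Succ (Var x)))) s1
       (\<lambda>s2. ensures ang ((m - Suc i) * (t + 5) + 2) ?W s2 Q)"
    proof (intro ensures_Seq ensures_mono[OF body[OF i(1)] order_refl] ensures_Assign)
      fix s2 assume "vars s2 x = i \<and> vars s2 ''m'' = m \<and>
        I (Suc i) (s2\<lparr>vars := (vars s2)(x := Suc i)\<rparr>)"
      then show "ensures ang ((m - Suc i) * (t + 5) + 2) ?W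
         (s2\<lparr>vars := (vars s2)(x := exp_val (Succ (Var x)) s2)\<rparr>) Q"
        using x i by (intro Suc.hyps(1)) auto
    qed (use Suc.prems in auto)
    from ensures_Seq[OF this]
    have "ensures ang (((t + 1 + 1) + ((m - Suc i) * (t + 5) + 2) + 1) + 2) ?W s1 Q"
      by (rule ensures_While) (use Suc.prems i in auto)
    then have "ensures ang (Suc (m - Suc i) * (t + 5) + 2) ?W s1 Q"
      by (rule ensures_mono) (simp_all only: mult_Suc)
    then show ?case unfolding Suc_diff_Suc[OF i(1)] .
  qed
  have "ensures ang (1 + (m * (t + 5) + 2) + 1) (For x c) s Q"
    unfolding For_def using W[of 0] init m x
    by (intro ensures_Seq ensures_Assign) auto
  moreover have "1 + (m * (t + 5) + 2) + 1 \<le> L * (t + 5) + 4"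
    using mult_le_mono1[OF m(2), of "t + 5"] by linarith
  ultimately show ?thesis by (rule ensures_mono)
qed

text \<open>
  Loops whose round \<open>i\<close> contributes a set \<open>Z i\<close> to a set \<open>acc\<close> that can be read off the state; nested loops
  then yield nested unions. The number \<open>cnt\<close>, which each round increases by at most \<open>B\<close>, bounds the length
  of the stored list independently of repetitions.
\<close>

lemma ensures_For_collect:
  fixes acc :: "state \<Rightarrow> 'b set" and cnt :: "state \<Rightarrow> nat"
  assumes m: "vars s ''m'' = m" "m \<le> L" and x: "x \<noteq> ''m''" "x \<notin> X" "''m'' \<notin> X"
    and acc: "\<And>s v. acc (s\<lparr>vars := (vars s)(x := v)\<rparr>) = acc s"
    and cnt: "\<And>s v. cnt (s\<lparr>vars := (vars s)(x := v)\<rparr>) = cnt s"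
    and body: "\<And>i s1. i < m \<Longrightarrow> frame (insert x X) A s s1 \<Longrightarrow> vars s1 x = i \<Longrightarrow>
       ensures ang t c s1 (\<lambda>s2. frame X A s1 s2 \<and> acc s2 = acc s1 \<union> Z i \<and> cnt s2 \<le> cnt s1 + B)"
  shows "ensures ang (L * (t + 5) + 4) (For x c) s
     (\<lambda>s2. frame (insert x X) A s s2 \<and> acc s2 = acc s \<union> (\<Union>i<m. Z i) \<and> cnt s2 \<le> cnt s + L * B)"
proof -
  define I where "I i s1 \<longleftrightarrow> frame (insert x X) A s s1 \<and> acc s1 = acc s \<union> (\<Union>j<i. Z j) \<and>
    cnt s1 \<le> cnt s + i * B" for i s1
  show ?thesis
  proof (rule ensures_For[where I = I, OF _ m x(1)])
    show "I 0 (s\<lparr>vars := (vars s)(x := 0)\<rparr>)"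
      unfolding I_def acc cnt by (simp add: frame_def)
  next
    fix i s1 assume i: "i < m" "I i s1" "vars s1 x = i" "vars s1 ''m'' = m"
    show "ensures ang t c s1 (\<lambda>s2. vars s2 x = i \<and> vars s2 ''m'' = m \<and>
          I (Suc i) (s2\<lparr>vars := (vars s2)(x := Suc i)\<rparr>))"
    proof (rule ensures_mono[OF body[OF i(1) _ i(3)] order_refl])
      show "frame (insert x X) A s s1" using i by (simp add: I_def)
    next
      fix s2 assume s2: "frame X A s1 s2 \<and> acc s2 = acc s1 \<union> Z i \<and> cnt s2 \<le> cnt s1 + B"
      then have "frame (insert x X) A s s2" 
        using i(2) frame_trans[of "insert x X" A s s1 X A s2 "insert x X" A] by (auto simp: I_def)
      then have "frame (insert x X) A s (s2\<lparr>vars := (vars s2)(x := Suc i)\<rparr>)"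
        by (auto simp: frame_def)
      then show "vars s2 x = i \<and> vars s2 ''m'' = m \<and>
          I (Suc i) (s2\<lparr>vars := (vars s2)(x := Suc i)\<rparr>)"
        using s2 i x unfolding I_def acc cnt lessThan_Suc by (auto simp: frame_def)
    qed
  next
    fix s' assume "I m s'"
    moreover have "m * B \<le> L * B" using m by simp
    ultimately show "frame (insert x X) A s s' \<and> acc s' = acc s \<union> (\<Union>i<m. Z i) \<and> cnt s' \<le> cnt s + L * B"
      unfolding I_def by (elim conjE, intro conjI) (assumption, assumption, erule order_trans, simp)
  qed
qed

section \<open>A program for Local Search\<close>

text \<open>
  The input gives the edges by their ends in the arrays \<open>src\<close> and \<open>tgt\<close>, and \<open>m\<close> is their number. The
  array \<open>M\<close> holds the 0/1 vector of the current edge set. The variables \<open>a\<close>, \<open>b\<close>, \<open>c\<close> run through the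
  triples of edges, the arrays \<open>c1\<close>, \<open>c2\<close>, \<open>c3\<close> store the \<open>cnt\<close> admissible triples found so far, \<open>r\<close>
  is the index of the chosen one, and \<open>chg\<close> records whether the current iteration changed the set.
\<close>

definition for_time :: "nat \<Rightarrow> nat \<Rightarrow> nat" where
  "for_time L t = L * (t + 5) + 4"

abbreviation EqC :: "exp \<Rightarrow> exp \<Rightarrow> cond" where
  "EqC e f \<equiv> Both (Negate (Less e f)) (Negate (Less f e))"

abbreviation OrC :: "cond \<Rightarrow> cond \<Rightarrow> cond" where
  "OrC b c \<equiv> Negate (Both (Negate b) (Negate c))"

definition touch :: "(name \<Rightarrow> nat \<Rightarrow> nat) \<Rightarrow> nat \<Rightarrow> nat \<Rightarrow> bool" where
  "touch A k i \<longleftrightarrow> A ''src'' k = A ''src'' i \<or> A ''src'' k = A ''tgt'' i \<or>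
     A ''tgt'' k = A ''src'' i \<or> A ''tgt'' k = A ''tgt'' i"

definition touchC :: "name \<Rightarrow> name \<Rightarrow> cond" where
  "touchC x y =
     OrC (OrC (EqC (Elem ''src'' (Var x)) (Elem ''src'' (Var y)))
              (EqC (Elem ''src'' (Var x)) (Elem ''tgt'' (Var y))))
         (OrC (EqC (Elem ''tgt'' (Var x)) (Elem ''src'' (Var y)))
              (EqC (Elem ''tgt'' (Var x)) (Elem ''tgt'' (Var y))))"

text \<open>
  Edge \<open>i\<close> belongs to the set \<open>M - {a} \<union> {b, c}\<close>. The test reads this set off \<open>M\<close>
  without writing to \<open>M\<close>, so nothing has to be restored afterwards.
\<close>

definition picked :: "(nat \<Rightarrow> nat) \<Rightarrow> nat \<Rightarrow> nat \<Rightarrow> nat \<Rightarrow> nat \<Rightarrow> bool" where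
  "picked M a b c i \<longleftrightarrow> i = b \<or> i = c \<or> 0 < M i \<and> i \<noteq> a"

definition pickedC :: "name \<Rightarrow> cond" where
  "pickedC x = OrC (OrC (EqC (Var x) (Var ''b'')) (EqC (Var x) (Var ''c'')))
     (Both (Less (Const 0) (Elem ''M'' (Var x))) (Negate (EqC (Var x) (Var ''a''))))"

text \<open>
  The negation of the criterion in \<open>induced_matching_iff\<close> for the set described by \<open>picked\<close>.
\<close>

definition clash :: "(name \<Rightarrow> nat \<Rightarrow> nat) \<Rightarrow> nat \<Rightarrow> nat \<Rightarrow> nat \<Rightarrow> nat \<Rightarrow> bool" where
  "clash A m a b c \<longleftrightarrow> (\<exists>i<m. \<exists>j<m. \<exists>k<m. picked (A ''M'') a b c i \<and> picked (A ''M'') a b c j \<and>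
     i \<noteq> j \<and> touch A k i \<and> touch A k j)"

definition check :: com where
  "check = Seq (Assign ''ok'' (Const 1)) (For ''i'' (For ''j'' (For ''k''
     (Branch (Both (Both (pickedC ''i'') (pickedC ''j''))
               (Both (Negate (EqC (Var ''i'') (Var ''j'')))
                     (Both (touchC ''k'' ''i'') (touchC ''k'' ''j''))))
        (Assign ''ok'' (Const 0)) Skip))))"

lemma touchC_iff: "cond_val (touchC x y) s \<longleftrightarrow> touch (arrays s) (vars s x) (vars s y)"
  by (auto simp: touchC_def touch_def)

lemma pickedC_iff:
  "cond_val (pickedC x) s \<longleftrightarrow>
     picked (arrays s ''M'') (vars s ''a'') (vars s ''b'') (vars s ''c'') (vars s x)"
  by (auto simp: pickedC_def picked_def)

definition check_time :: "nat \<Rightarrow> nat" where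
  "check_time L = for_time L (for_time L (for_time L 2)) + 2"

lemma ensures_check:
  assumes m: "vars s ''m'' = m" "m \<le> L"
  shows "ensures ang (check_time L) check s (\<lambda>s'. frame {''i'', ''j'', ''k'', ''ok''} {} s s' \<and>
    (vars s' ''ok'' = 0 \<longleftrightarrow> clash (arrays s) m (vars s ''a'') (vars s ''b'') (vars s ''c'')))"
proof -
  define a b c A where "a = vars s ''a''" "b = vars s ''b''" "c = vars s ''c''" "A = arrays s"
  define P where "P i j k \<longleftrightarrow> picked (A ''M'') a b c i \<and> picked (A ''M'') a b c j \<and>
     i \<noteq> j \<and> touch A k i \<and> touch A k j" for i j k
  \<comment> \<open>The flag \<open>ok\<close> is cleared if some round finds a clash; as a subset of the unit type
    it is a union over the rounds.\<close>
  define acc where "acc s = {u::unit. vars s ''ok'' = 0}" for s :: state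
  let ?b = "Both (Both (pickedC ''i'') (pickedC ''j''))
               (Both (Negate (EqC (Var ''i'') (Var ''j'')))
                     (Both (touchC ''k'' ''i'') (touchC ''k'' ''j'')))"
  let ?i = "{''i'', ''j'', ''k'', ''ok''}"
  let ?cnt = "\<lambda>s :: state. 0 :: nat"
  have k: "ensures ang (for_time L 2) (For ''k'' (Branch ?b (Assign ''ok'' (Const 0)) Skip)) s1
     (\<lambda>s2. frame {''k'', ''ok''} {} s1 s2 \<and> acc s2 = acc s1 \<union> (\<Union>k<m. {u. P i j k}) \<and>
        ?cnt s2 \<le> ?cnt s1 + L * 0)"
    if s1: "frame ?i {} s s1" "vars s1 ''i'' = i" "vars s1 ''j'' = j" for s1 i j
    unfolding for_time_def
  proof (rule ensures_For_collect[OF _ m(2)])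
    fix k s2 assume s2: "frame {''k'', ''ok''} {} s1 s2" "vars s2 ''k'' = k"
    have v: "vars s2 ''i'' = i" "vars s2 ''j'' = j" "arrays s2 = A"
      "vars s2 ''a'' = a" "vars s2 ''b'' = b" "vars s2 ''c'' = c"
      using s1(2,3)
      by (simp_all add: frame_vars[OF s2(1)] frame_vars[OF s1(1)] frame_arrays[OF s2(1)]
          frame_arrays[OF s1(1)] a_b_c_A_def fun_eq_iff)
    have "cond_val ?b s2 \<longleftrightarrow> P i j k"
      by (auto simp: touchC_iff pickedC_iff v s2 P_def)
    then have "ensures ang (1 + 1) (Branch ?b (Assign ''ok'' (Const 0)) Skip) s2
       (\<lambda>s3. frame {''ok''} {} s2 s3 \<and> acc s3 = acc s2 \<union> {u. P i j k} \<and> ?cnt s3 \<le> ?cnt s2 + 0)"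
      by (intro ensures_Branch ensures_Assign ensures_Skip)
        (auto simp: acc_def intro: frame_assign frame_refl)
    then show "ensures ang 2 (Branch ?b (Assign ''ok'' (Const 0)) Skip) s2
       (\<lambda>s3. frame {''ok''} {} s2 s3 \<and> acc s3 = acc s2 \<union> {u. P i j k} \<and> ?cnt s3 \<le> ?cnt s2 + 0)"
      by (simp only: one_add_one)
  qed (simp_all add: frame_vars[OF s1(1)] m acc_def)
  have j: "ensures ang (for_time L (for_time L 2))
     (For ''j'' (For ''k'' (Branch ?b (Assign ''ok'' (Const 0)) Skip))) s1
     (\<lambda>s2. frame {''j'', ''k'', ''ok''} {} s1 s2 \<and>
        acc s2 = acc s1 \<union> (\<Union>j<m. \<Union>k<m. {u. P i j k}) \<and> ?cnt s2 \<le> ?cnt s1 + L * (L * 0))"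
    if s1: "frame ?i {} s s1" "vars s1 ''i'' = i" for s1 i
    unfolding for_time_def[of L "for_time L 2"]
  proof (rule ensures_For_collect[OF _ m(2)])
    fix j s2 assume s2: "frame {''j'', ''k'', ''ok''} {} s1 s2" "vars s2 ''j'' = j"
    have "frame ?i {} s s2" by (rule frame_trans[OF s1(1) s2(1)]) auto
    moreover have "vars s2 ''i'' = i" using s1(2) by (simp add: frame_vars[OF s2(1)])
    ultimately show "ensures ang (for_time L 2) (For ''k'' (Branch ?b (Assign ''ok'' (Const 0)) Skip)) s2
     (\<lambda>s3. frame {''k'', ''ok''} {} s2 s3 \<and> acc s3 = acc s2 \<union> (\<Union>k<m. {u. P i j k}) \<and>
        ?cnt s3 \<le> ?cnt s2 + L * 0)"
      using s2(2) by (rule k)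
  qed (simp_all add: frame_vars[OF s1(1)] m acc_def)
  have i: "ensures ang (for_time L (for_time L (for_time L 2)))
     (For ''i'' (For ''j'' (For ''k'' (Branch ?b (Assign ''ok'' (Const 0)) Skip)))) s1
     (\<lambda>s2. frame ?i {} s1 s2 \<and>
        acc s2 = acc s1 \<union> (\<Union>i<m. \<Union>j<m. \<Union>k<m. {u. P i j k}) \<and> ?cnt s2 \<le> ?cnt s1 + L * (L * (L * 0)))"
    if s1: "frame ?i {} s s1" for s1
    unfolding for_time_def[of L "for_time L (for_time L 2)"]
  proof (rule ensures_For_collect[OF _ m(2)])
    fix i s2 assume s2: "frame ?i {} s1 s2" "vars s2 ''i'' = i"
    have "frame ?i {} s s2" by (rule frame_trans[OF s1(1) s2(1)]) auto
    then show "ensures ang (for_time L (for_time L 2))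
       (For ''j'' (For ''k'' (Branch ?b (Assign ''ok'' (Const 0)) Skip))) s2
       (\<lambda>s3. frame {''j'', ''k'', ''ok''} {} s2 s3 \<and>
        acc s3 = acc s2 \<union> (\<Union>j<m. \<Union>k<m. {u. P i j k}) \<and> ?cnt s3 \<le> ?cnt s2 + L * (L * 0))"
      using s2(2) by (rule j)
  qed (simp_all add: frame_vars[OF s1(1)] m acc_def)
  have "ensures ang (1 + for_time L (for_time L (for_time L 2)) + 1) check s
    (\<lambda>s'. frame ?i {} s s' \<and> (vars s' ''ok'' = 0 \<longleftrightarrow> clash A m a b c))"
    unfolding check_def
  proof (intro ensures_Seq ensures_Assign, rule ensures_mono[OF i order_refl])
    let ?s = "s\<lparr>vars := (vars s)(''ok'' := exp_val (Const 1) s)\<rparr>"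
    show f: "frame ?i {} s ?s" by (intro frame_assign frame_refl) simp
    fix s' assume s': "frame ?i {} ?s s' \<and> acc s' = acc ?s \<union> (\<Union>i<m. \<Union>j<m. \<Union>k<m. {u. P i j k}) \<and>
        ?cnt s' \<le> ?cnt ?s + L * (L * (L * 0))"
    then have "frame ?i {} s s'" using frame_trans[OF f, of ?i "{}" s' ?i "{}"] by simp
    moreover have "vars s' ''ok'' = 0 \<longleftrightarrow> () \<in> acc s'" by (simp add: acc_def)
    moreover have "acc ?s = {}" by (simp add: acc_def)
    moreover have "() \<in> (\<Union>i<m. \<Union>j<m. \<Union>k<m. {u. P i j k}) \<longleftrightarrow> clash A m a b c"
      by (simp only: UN_iff mem_Collect_eq clash_def P_def Bex_def lessThan_iff)
    ultimately show "frame ?i {} s s' \<and> (vars s' ''ok'' = 0 \<longleftrightarrow> clash A m a b c)"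
      using s' by simp
  qed simp
  then show ?thesis by (simp add: check_time_def a_b_c_A_def)
qed

definition store :: com where
  "store = Branch (Less (Const 0) (Var ''ok''))
     (Seq (Store ''c1'' (Var ''cnt'') (Var ''a''))
     (Seq (Store ''c2'' (Var ''cnt'') (Var ''b''))
     (Seq (Store ''c3'' (Var ''cnt'') (Var ''c''))
          (Assign ''cnt'' (Succ (Var ''cnt''))))))
     Skip"

definition collect :: "cond \<Rightarrow> com" where
  "collect g = Seq (Assign ''cnt'' (Const 0))
     (For ''a'' (For ''b'' (For ''c'' (Branch g (Seq check store) Skip))))"

text \<open>
  The admissible triples, for a guard \<open>Gp\<close> that tells additions from swaps.
\<close>

definition cands :: "((nat \<Rightarrow> nat) \<Rightarrow> nat \<Rightarrow> nat \<Rightarrow> nat \<Rightarrow> bool) \<Rightarrow> (name \<Rightarrow> nat \<Rightarrow> nat) \<Rightarrow> nat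
    \<Rightarrow> (nat \<times> nat \<times> nat) set" where
  "cands Gp A m = {(a, b, c). a < m \<and> b < m \<and> c < m \<and> Gp (A ''M'') a b c \<and> \<not> clash A m a b c}"

definition stored :: "state \<Rightarrow> (nat \<times> nat \<times> nat) set" where
  "stored s = (\<lambda>r. (arrays s ''c1'' r, arrays s ''c2'' r, arrays s ''c3'' r)) ` {..<vars s ''cnt''}"

lemma ensures_store:
  "ensures ang 8 store s (\<lambda>s'. frame {''cnt''} {''c1'', ''c2'', ''c3''} s s' \<and>
     stored s' = stored s \<union> (if vars s ''ok'' = 0 then {} else {(vars s ''a'', vars s ''b'', vars s ''c'')}) \<and>
     vars s' ''cnt'' \<le> vars s ''cnt'' + 1)"
proof -
  have "ensures ang ((1 + (1 + (1 + 1 + 1) + 1) + 1) + 1) store s (\<lambda>s'. frame {''cnt''} {''c1'', ''c2'', ''c3''} s s' \<and>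
     stored s' = stored s \<union> (if vars s ''ok'' = 0 then {} else {(vars s ''a'', vars s ''b'', vars s ''c'')}) \<and>
     vars s' ''cnt'' \<le> vars s ''cnt'' + 1)"
    unfolding store_def
    by (intro ensures_Branch ensures_Seq ensures_Store ensures_Assign ensures_Skip)
      (simp_all add: frame_def stored_def lessThan_Suc)
  then show ?thesis by (rule ensures_mono) simp_all
qed

definition collect_time :: "nat \<Rightarrow> nat" where
  "collect_time L = for_time L (for_time L (for_time L (check_time L + 10))) + 2"

lemma clash_cong:
  "A ''src'' = A' ''src'' \<Longrightarrow> A ''tgt'' = A' ''tgt'' \<Longrightarrow> A ''M'' = A' ''M'' \<Longrightarrow> clash A = clash A'"
  by (intro ext) (simp add: clash_def touch_def)

text \<open>
  The bound on \<open>cnt\<close> is one store per triple; it bounds the time of the subsequent choice.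
\<close>

lemma ensures_collect:
  assumes m: "vars s ''m'' = m" "m \<le> L"
    and g: "\<And>s. cond_val g s \<longleftrightarrow> Gp (arrays s ''M'') (vars s ''a'') (vars s ''b'') (vars s ''c'')"
  shows "ensures ang (collect_time L) (collect g) s
    (\<lambda>s'. frame {''a'', ''b'', ''c'', ''i'', ''j'', ''k'', ''ok'', ''cnt''} {''c1'', ''c2'', ''c3''} s s' \<and>
      stored s' = cands Gp (arrays s) m \<and> vars s' ''cnt'' \<le> L * (L * L))"
proof -
  define A where "A = arrays s"
  define P where "P a b c \<longleftrightarrow> Gp (A ''M'') a b c \<and> \<not> clash A m a b c" for a b c
  let ?cnt = "\<lambda>s :: state. vars s ''cnt''"
  let ?A = "{''c1'', ''c2'', ''c3''}" and ?X = "{''i'', ''j'', ''k'', ''ok'', ''cnt''}"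
  let ?B = "Branch g (Seq check store) Skip"
  let ?F = "{''a'', ''b'', ''c'', ''i'', ''j'', ''k'', ''ok'', ''cnt''}"
  have body: "ensures ang (check_time L + 10) ?B s1
     (\<lambda>s2. frame ?X ?A s1 s2 \<and> stored s2 = stored s1 \<union> {t. t = (a, b, c) \<and> P a b c} \<and>
        ?cnt s2 \<le> ?cnt s1 + 1)"
    if s1: "frame ?F ?A s s1" and v: "vars s1 ''a'' = a" "vars s1 ''b'' = b" "vars s1 ''c'' = c"
    for s1 a b c
  proof -
    have M: "arrays s1 ''M'' = A ''M''"
      by (simp add: A_def frame_arrays[OF s1])
    have clash: "clash (arrays s1) = clash A"
      by (rule clash_cong) (simp_all add: A_def frame_arrays[OF s1])
    have m1: "vars s1 ''m'' = m" using frame_vars[OF s1] m(1) by simp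
    have "ensures ang (check_time L + 8 + 1 + 1) ?B s1
     (\<lambda>s2. frame ?X ?A s1 s2 \<and> stored s2 = stored s1 \<union> {t. t = (a, b, c) \<and> P a b c} \<and>
        ?cnt s2 \<le> ?cnt s1 + 1)"
    proof (rule ensures_Branch)
      assume gt: "cond_val g s1"
      show "ensures ang (check_time L + 8 + 1) (Seq check store) s1
       (\<lambda>s2. frame ?X ?A s1 s2 \<and> stored s2 = stored s1 \<union> {t. t = (a, b, c) \<and> P a b c} \<and>
          ?cnt s2 \<le> ?cnt s1 + 1)"
      proof (intro ensures_Seq, rule ensures_mono[OF ensures_check[OF m1 m(2)] order_refl], elim conjE)
        fix s2 assume s2: "frame {''i'', ''j'', ''k'', ''ok''} {} s1 s2"
          and ok: "(vars s2 ''ok'' = 0) =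
            clash (arrays s1) m (vars s1 ''a'') (vars s1 ''b'') (vars s1 ''c'')"
        have v2: "vars s2 ''a'' = a" "vars s2 ''b'' = b" "vars s2 ''c'' = c" "?cnt s2 = ?cnt s1"
          using frame_vars[OF s2] v by simp_all
        have st: "stored s2 = stored s1"
          unfolding stored_def v2 using frame_arrays[OF s2] by simp
        have ok': "(if vars s2 ''ok'' = 0 then {} else {(a, b, c)}) = {t. t = (a, b, c) \<and> P a b c}"
          using gt ok by (simp add: P_def g M clash v)
        show "ensures ang 8 store s2 (\<lambda>s2. frame ?X ?A s1 s2 \<and>
             stored s2 = stored s1 \<union> {t. t = (a, b, c) \<and> P a b c} \<and> ?cnt s2 \<le> ?cnt s1 + 1)"
        proof (rule ensures_mono[OF ensures_store order_refl], elim conjE, intro conjI)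
          fix s3 assume s3: "frame {''cnt''} ?A s2 s3"
          show "frame ?X ?A s1 s3" by (rule frame_trans[OF s2 s3]) auto
        qed (simp_all only: v2 st ok')
      qed
    next
      assume "\<not> cond_val g s1"
      then show "ensures ang (check_time L + 8 + 1) Skip s1
       (\<lambda>s2. frame ?X ?A s1 s2 \<and> stored s2 = stored s1 \<union> {t. t = (a, b, c) \<and> P a b c} \<and>
          ?cnt s2 \<le> ?cnt s1 + 1)"
        by (intro ensures_Skip) (simp add: g P_def M v frame_refl)
    qed
    then show ?thesis by (rule ensures_mono) simp_all
  qed
  have c: "ensures ang (for_time L (check_time L + 10)) (For ''c'' ?B) s1
     (\<lambda>s2. frame (insert ''c'' ?X) ?A s1 s2 \<and>
        stored s2 = stored s1 \<union> (\<Union>c<m. {t. t = (a, b, c) \<and> P a b c}) \<and> ?cnt s2 \<le> ?cnt s1 + L * 1)"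
    if s1: "frame ?F ?A s s1" and v: "vars s1 ''a'' = a" "vars s1 ''b'' = b" for s1 a b
    unfolding for_time_def
  proof (rule ensures_For_collect[OF _ m(2)])
    fix c s2 assume s2: "frame (insert ''c'' ?X) ?A s1 s2" "vars s2 ''c'' = c"
    have "frame ?F ?A s s2" by (rule frame_trans[OF s1 s2(1)]) auto
    moreover have "vars s2 ''a'' = a" "vars s2 ''b'' = b" using v frame_vars[OF s2(1)] by simp_all
    ultimately show "ensures ang (check_time L + 10) ?B s2
     (\<lambda>s3. frame ?X ?A s2 s3 \<and> stored s3 = stored s2 \<union> {t. t = (a, b, c) \<and> P a b c} \<and>
        ?cnt s3 \<le> ?cnt s2 + 1)"
      using s2(2) by (rule body)
  qed (simp_all add: frame_vars[OF s1] m stored_def)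
  have b: "ensures ang (for_time L (for_time L (check_time L + 10))) (For ''b'' (For ''c'' ?B)) s1
     (\<lambda>s2. frame (insert ''b'' (insert ''c'' ?X)) ?A s1 s2 \<and>
        stored s2 = stored s1 \<union> (\<Union>b<m. \<Union>c<m. {t. t = (a, b, c) \<and> P a b c}) \<and>
        ?cnt s2 \<le> ?cnt s1 + L * (L * 1))"
    if s1: "frame ?F ?A s s1" and v: "vars s1 ''a'' = a" for s1 a
    unfolding for_time_def[of L "for_time L (check_time L + 10)"]
  proof (rule ensures_For_collect[OF _ m(2)])
    fix b s2 assume s2: "frame (insert ''b'' (insert ''c'' ?X)) ?A s1 s2" "vars s2 ''b'' = b"
    have "frame ?F ?A s s2" by (rule frame_trans[OF s1 s2(1)]) auto
    moreover have "vars s2 ''a'' = a" using v frame_vars[OF s2(1)] by simp_all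
    ultimately show "ensures ang (for_time L (check_time L + 10)) (For ''c'' ?B) s2
     (\<lambda>s3. frame (insert ''c'' ?X) ?A s2 s3 \<and>
        stored s3 = stored s2 \<union> (\<Union>c<m. {t. t = (a, b, c) \<and> P a b c}) \<and>
        ?cnt s3 \<le> ?cnt s2 + L * 1)"
      using s2(2) by (rule c)
  qed (simp_all add: frame_vars[OF s1] m stored_def)
  have a: "ensures ang (for_time L (for_time L (for_time L (check_time L + 10))))
     (For ''a'' (For ''b'' (For ''c'' ?B))) s1
     (\<lambda>s2. frame (insert ''a'' (insert ''b'' (insert ''c'' ?X))) ?A s1 s2 \<and>
        stored s2 = stored s1 \<union> (\<Union>a<m. \<Union>b<m. \<Union>c<m. {t. t = (a, b, c) \<and> P a b c}) \<and>
        ?cnt s2 \<le> ?cnt s1 + L * (L * (L * 1)))"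
    if s1: "frame ?F ?A s s1" for s1
    unfolding for_time_def[of L "for_time L (for_time L (check_time L + 10))"]
  proof (rule ensures_For_collect[OF _ m(2)])
    fix a s2 assume s2: "frame (insert ''a'' (insert ''b'' (insert ''c'' ?X))) ?A s1 s2" "vars s2 ''a'' = a"
    have "frame ?F ?A s s2" by (rule frame_trans[OF s1 s2(1)]) auto
    then show "ensures ang (for_time L (for_time L (check_time L + 10))) (For ''b'' (For ''c'' ?B)) s2
     (\<lambda>s3. frame (insert ''b'' (insert ''c'' ?X)) ?A s2 s3 \<and>
        stored s3 = stored s2 \<union> (\<Union>b<m. \<Union>c<m. {t. t = (a, b, c) \<and> P a b c}) \<and>
        ?cnt s3 \<le> ?cnt s2 + L * (L * 1))"
      using s2(2) by (rule b)
  qed (simp_all add: frame_vars[OF s1] m stored_def)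
  have "ensures ang (1 + for_time L (for_time L (for_time L (check_time L + 10))) + 1) (collect g) s
    (\<lambda>s'. frame ?F ?A s s' \<and> stored s' = cands Gp A m \<and> vars s' ''cnt'' \<le> L * (L * L))"
    unfolding collect_def
  proof (intro ensures_Seq ensures_Assign, rule ensures_mono[OF a order_refl])
    let ?s = "s\<lparr>vars := (vars s)(''cnt'' := exp_val (Const 0) s)\<rparr>"
    show f: "frame ?F ?A s ?s" by (intro frame_assign frame_refl) simp
    fix s' assume s': "frame (insert ''a'' (insert ''b'' (insert ''c'' ?X))) ?A ?s s' \<and>
        stored s' = stored ?s \<union> (\<Union>a<m. \<Union>b<m. \<Union>c<m. {t. t = (a, b, c) \<and> P a b c}) \<and>
        ?cnt s' \<le> ?cnt ?s + L * (L * (L * 1))"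
    then have "frame ?F ?A s s'" using frame_trans[OF f, of ?F ?A s' ?F ?A] by simp
    moreover have "stored ?s = {}" by (simp add: stored_def)
    moreover have "(\<Union>a<m. \<Union>b<m. \<Union>c<m. {t. t = (a, b, c) \<and> P a b c}) = cands Gp A m"
      by (auto simp: cands_def P_def)
    ultimately show "frame ?F ?A s s' \<and> stored s' = cands Gp A m \<and> ?cnt s' \<le> L * (L * L)"
      using s' by simp
  qed simp
  then show ?thesis by (simp add: collect_time_def A_def)
qed

text \<open>
  A walk along the indices below \<open>cnt\<close> that may stop anywhere and has to stop at the last one.
\<close>

definition pick_index :: com where
  "pick_index = Seq (Assign ''r'' (Const 0)) (Seq (Assign ''go'' (Const 0))
     (While (Both (Less (Succ (Var ''r'')) (Var ''cnt'')) (Less (Var ''go'') (Const 1)))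
        (Or (Assign ''r'' (Succ (Var ''r''))) (Assign ''go'' (Const 1)))))"

text \<open>
  The assumption on \<open>W\<close> is what the two readings require: an angel needs one index in \<open>W\<close>, against a
  demon all of them have to be in \<open>W\<close>.
\<close>

lemma ensures_pick_index:
  assumes "vars s ''cnt'' = n" "0 < n" "n \<le> N"
    and W: "if ang then \<exists>r\<in>W. r < n else {..<n} \<subseteq> W"
  shows "ensures ang (5 * N + 6) pick_index s
    (\<lambda>s'. frame {''r'', ''go''} {} s s' \<and> vars s' ''r'' \<in> W \<and> vars s' ''r'' < n)"
proof -
  let ?Q = "\<lambda>s'. frame {''r'', ''go''} {} s s' \<and> vars s' ''r'' \<in> W \<and> vars s' ''r'' < n"
  let ?g = "Both (Less (Succ (Var ''r'')) (Var ''cnt'')) (Less (Var ''go'') (Const 1))"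
  let ?B = "Or (Assign ''r'' (Succ (Var ''r''))) (Assign ''go'' (Const 1))"
  have loop: "ensures ang (5 * (n - r) + 2) (While ?g ?B) s1 ?Q"
    if "frame {''r'', ''go''} {} s s1" "vars s1 ''r'' = r" "r < n" "vars s1 ''go'' = 0"
      "if ang then \<exists>t\<in>W. r \<le> t \<and> t < n else {r..<n} \<subseteq> W" for r s1
    using that
  proof (induction "n - r" arbitrary: r s1 rule: less_induct)
    case less
    have cnt: "vars s1 ''cnt'' = n" using frame_vars[OF less.prems(1)] assms(1) by simp
    show ?case
    proof (cases "Suc r < n")
      case False
      have "\<exists>t\<in>W. r \<le> t \<and> t < n"
      proof (cases ang)
        case False
        then have "r \<in> W" using less.prems(3,5) by (simp add: subset_iff)
        then show ?thesis using less.prems(3) by blast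
      qed (use less.prems(5) in simp)
      then obtain t where "t \<in> W" "r \<le> t" "t < n" by blast
      moreover from this have "t = r" using False by linarith
      ultimately have "r \<in> W" by simp
      then show ?thesis using False less.prems cnt
        by (intro ensures_While) auto
    next
      case True
      let ?s2 = "s1\<lparr>vars := (vars s1)(''r'' := exp_val (Succ (Var ''r'')) s1)\<rparr>"
      let ?s3 = "s1\<lparr>vars := (vars s1)(''go'' := exp_val (Const 1) s1)\<rparr>"
      let ?R = "\<lambda>s2. ensures ang (5 * (n - Suc r) + 2) (While ?g ?B) s2 ?Q"
      have inc: "?R ?s2" if "if ang then \<exists>t\<in>W. Suc r \<le> t \<and> t < n else {Suc r..<n} \<subseteq> W"
      proof (rule less.hyps)
        show "frame {''r'', ''go''} {} s ?s2" using less.prems(1) by (intro frame_assign) auto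
      qed (use True that less.prems in auto)
      \<comment> \<open>Setting \<open>go\<close> falsifies the loop condition, so the walk ends at the present index.\<close>
      have stop: "?R ?s3" if "r \<in> W"
      proof (rule ensures_While)
        have "frame {''r'', ''go''} {} s ?s3" using less.prems(1) by (intro frame_assign) auto
        then show "?Q ?s3" using less.prems that by simp
      qed simp
      have "ensures ang (1 + 1) ?B s1 ?R"
      proof (rule ensures_Or, cases ang)
        case True
        with less.prems(5) obtain t where t: "t \<in> W" "r \<le> t" "t < n" by auto
        show "if ang then ensures ang 1 (Assign ''r'' (Succ (Var ''r''))) s1 ?R \<or>
              ensures ang 1 (Assign ''go'' (Const 1)) s1 ?R
          else ensures ang 1 (Assign ''r'' (Succ (Var ''r''))) s1 ?R \<and>
              ensures ang 1 (Assign ''go'' (Const 1)) s1 ?R"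
        proof (cases "t = r")
          case False
          then have "Suc r \<le> t" using t by simp
          then have "?R ?s2" using inc True t by auto
          then show ?thesis using True ensures_Assign[of ?R s1] by simp
        next
          case eq: True
          then have "?R ?s3" using stop t by auto
          then show ?thesis using True ensures_Assign[of ?R s1] by simp
        qed
      next
        case False
        then have "{r..<n} \<subseteq> W" using less.prems(5) by simp
        then have "?R ?s2" "?R ?s3" using inc stop False True \<open>r < n\<close> by (auto simp: subset_iff)
        then show "if ang then ensures ang 1 (Assign ''r'' (Succ (Var ''r''))) s1 ?R \<or>
              ensures ang 1 (Assign ''go'' (Const 1)) s1 ?R
          else ensures ang 1 (Assign ''r'' (Succ (Var ''r''))) s1 ?R \<and>
              ensures ang 1 (Assign ''go'' (Const 1)) s1 ?R"
          using False ensures_Assign[of ?R s1] by simp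
      qed
      from ensures_Seq[OF this]
      have "ensures ang (((1 + 1) + (5 * (n - Suc r) + 2) + 1) + 2) (While ?g ?B) s1 ?Q"
        by (rule ensures_While) (use True less.prems cnt in auto)
      then show ?thesis by (rule ensures_mono) (use True in auto)
    qed
  qed
  have "ensures ang (1 + (1 + (5 * (n - 0) + 2) + 1) + 1) pick_index s ?Q"
    unfolding pick_index_def
    by (intro ensures_Seq ensures_Assign loop)
      (use assms in \<open>simp_all add: frame_def atLeast0LessThan\<close>)
  then show ?thesis by (rule ensures_mono) (use assms in auto)
qed

text \<open>
  The 0 is written before the 1s, so that the case \<open>a = b = c\<close> of an addition puts the edge into the
  set.
\<close>

definition apply_pick :: com where
  "apply_pick = Seq (Store ''M'' (Elem ''c1'' (Var ''r'')) (Const 0))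
     (Seq (Store ''M'' (Elem ''c2'' (Var ''r'')) (Const 1))
     (Seq (Store ''M'' (Elem ''c3'' (Var ''r'')) (Const 1))
          (Assign ''chg'' (Const 1))))"

definition phase :: "cond \<Rightarrow> com" where
  "phase g = Seq (collect g) (Branch (Less (Const 0) (Var ''cnt'')) (Seq pick_index apply_pick) Skip)"

definition phase_time :: "nat \<Rightarrow> nat" where
  "phase_time L = collect_time L + 5 * (L * (L * L)) + 16"

abbreviation (input) scratch :: "name set" where
  "scratch \<equiv> {''a'', ''b'', ''c'', ''i'', ''j'', ''k'', ''ok'', ''cnt'', ''r'', ''go'', ''chg''}"

abbreviation (input) scratch_arrays :: "name set" where
  "scratch_arrays \<equiv> {''c1'', ''c2'', ''c3'', ''M''}"

text \<open>
  The set \<open>T\<close> plays the role of \<open>W\<close> in the choice of the index: for angelic choices it may single out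
  any admissible triple, for demonic choices it has to contain all of them.
\<close>

lemma ensures_phase:
  assumes m: "vars s ''m'' = m" "m \<le> L"
    and g: "\<And>s. cond_val g s \<longleftrightarrow> Gp (arrays s ''M'') (vars s ''a'') (vars s ''b'') (vars s ''c'')"
    and T: "if ang then cands Gp (arrays s) m \<noteq> {} \<longrightarrow> cands Gp (arrays s) m \<inter> T \<noteq> {}
      else cands Gp (arrays s) m \<subseteq> T"
  shows "ensures ang (phase_time L) (phase g) s (\<lambda>s'. frame scratch scratch_arrays s s' \<and>
     (if cands Gp (arrays s) m = {} then arrays s' ''M'' = arrays s ''M'' \<and> vars s' ''chg'' = vars s ''chg''
      else vars s' ''chg'' = 1 \<and>
        (\<exists>(a, b, c) \<in> cands Gp (arrays s) m \<inter> T. arrays s' ''M'' = (arrays s ''M'')(a := 0, b := 1, c := 1))))"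
proof -
  let ?C = "cands Gp (arrays s) m"
  let ?N = "L * (L * L)"
  let ?Q = "\<lambda>s'. frame scratch scratch_arrays s s' \<and>
     (if ?C = {} then arrays s' ''M'' = arrays s ''M'' \<and> vars s' ''chg'' = vars s ''chg''
      else vars s' ''chg'' = 1 \<and>
        (\<exists>(a, b, c) \<in> ?C \<inter> T. arrays s' ''M'' = (arrays s ''M'')(a := 0, b := 1, c := 1)))"
  have "ensures ang (collect_time L + ((5 * ?N + 6) + (1 + (1 + (1 + 1 + 1) + 1) + 1) + 1 + 1) + 1) (phase g) s ?Q"
    unfolding phase_def
  proof (intro ensures_Seq, rule ensures_mono[OF ensures_collect[OF m g] order_refl], elim conjE)
    fix s1 assume s1: "frame {''a'', ''b'', ''c'', ''i'', ''j'', ''k'', ''ok'', ''cnt''} {''c1'', ''c2'', ''c3''} s s1"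
      and st: "stored s1 = ?C" and n: "vars s1 ''cnt'' \<le> ?N"
    have f1: "frame scratch scratch_arrays s s1" by (rule frame_trans[OF s1 frame_refl]) auto
    have M: "arrays s1 ''M'' = arrays s ''M''" "vars s1 ''chg'' = vars s ''chg''"
      using frame_arrays[OF s1] frame_vars[OF s1] by simp_all
    show "ensures ang ((5 * ?N + 6) + (1 + (1 + (1 + 1 + 1) + 1) + 1) + 1 + 1)
       (Branch (Less (Const 0) (Var ''cnt'')) (Seq pick_index apply_pick) Skip) s1 ?Q"
    proof (rule ensures_Branch)
      assume "\<not> cond_val (Less (Const 0) (Var ''cnt'')) s1"
      then have "?C = {}" using st by (simp add: stored_def)
      then show "ensures ang ((5 * ?N + 6) + (1 + (1 + (1 + 1 + 1) + 1) + 1) + 1) Skip s1 ?Q"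
        using f1 M by (intro ensures_Skip) simp
    next
      assume "cond_val (Less (Const 0) (Var ''cnt'')) s1"
      then have pos: "0 < vars s1 ''cnt''" by simp
      then have ne: "?C \<noteq> {}" unfolding st[symmetric] stored_def by (auto simp: lessThan_empty_iff)
      define f where "f r = (arrays s1 ''c1'' r, arrays s1 ''c2'' r, arrays s1 ''c3'' r)" for r
      have fC: "?C = f ` {..<vars s1 ''cnt''}" unfolding st[symmetric] stored_def f_def ..
      \<comment> \<open>indices at which a triple of \<open>T\<close> is stored\<close>
      define W where "W = {r. f r \<in> T}"
      have W: "if ang then \<exists>r\<in>W. r < vars s1 ''cnt'' else {..<vars s1 ''cnt''} \<subseteq> W"
      proof (cases ang)
        case True
        then have "?C \<inter> T \<noteq> {}" using T ne by simp
        then show ?thesis using True unfolding fC W_def by auto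
      next
        case False
        then have "?C \<subseteq> T" using T by simp
        then show ?thesis using False unfolding fC W_def by auto
      qed
      show "ensures ang ((5 * ?N + 6) + (1 + (1 + (1 + 1 + 1) + 1) + 1) + 1) (Seq pick_index apply_pick) s1 ?Q"
      proof (intro ensures_Seq,
          rule ensures_mono[OF ensures_pick_index[OF refl pos n W] order_refl], elim conjE)
        fix s2 assume s2: "frame {''r'', ''go''} {} s1 s2"
          and r: "vars s2 ''r'' \<in> W" "vars s2 ''r'' < vars s1 ''cnt''"
        have f2: "frame scratch scratch_arrays s s2" by (rule frame_trans[OF f1 s2]) auto
        define r where "r = vars s2 ''r''"
        obtain a b c where abc: "f r = (a, b, c)" by (cases "f r")
        have in_C: "(a, b, c) \<in> ?C \<inter> T" using r unfolding fC W_def r_def[symmetric] abc[symmetric] by auto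
        have A: "arrays s2 ''c1'' r = a" "arrays s2 ''c2'' r = b" "arrays s2 ''c3'' r = c"
          "arrays s2 ''M'' = arrays s ''M''"
          using abc frame_arrays[OF s2] M by (simp_all add: f_def)
        define Q where "Q = ?Q"
        have "frame scratch scratch_arrays s (s2\<lparr>arrays := (arrays s2)(''M'' := (arrays s ''M'')(a := 0, b := Suc 0, c := Suc 0)),
             vars := (vars s2)(''chg'' := Suc 0)\<rparr>)"
          using f2 by (simp add: frame_def)
        then have "Q (s2\<lparr>arrays := (arrays s2)(''M'' := (arrays s ''M'')(a := 0, b := Suc 0, c := Suc 0)),
             vars := (vars s2)(''chg'' := Suc 0)\<rparr>)"
          unfolding Q_def using ne in_C by auto
        then have "ensures ang (1 + (1 + (1 + 1 + 1) + 1) + 1) apply_pick s2 Q"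
          unfolding apply_pick_def
          by (intro ensures_Seq ensures_Store ensures_Assign) (simp_all add: A r_def[symmetric])
        then show "ensures ang (1 + (1 + (1 + 1 + 1) + 1) + 1) apply_pick s2 ?Q"
          unfolding Q_def .
      qed
    qed
  qed
  then show ?thesis by (rule ensures_mono) (simp add: phase_time_def, assumption)
qed

definition print_set :: com where
  "print_set = For ''i'' (Print (Elem ''M'' (Var ''i'')))"

lemma ensures_print_set:
  assumes m: "vars s ''m'' = m" "m \<le> L"
  shows "ensures ang (for_time L 1) print_set s (\<lambda>s'. (\<forall>x. x \<noteq> ''i'' \<longrightarrow> vars s' x = vars s x) \<and>
     arrays s' = arrays s \<and> printed s' = printed s @ map (arrays s ''M'') [0..<m])"
  unfolding print_set_def for_time_def
proof (rule ensures_For[where I = "\<lambda>i s'. (\<forall>x. x \<noteq> ''i'' \<longrightarrow> vars s' x = vars s x) \<and>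
     arrays s' = arrays s \<and> printed s' = printed s @ map (arrays s ''M'') [0..<i]", OF _ m])
  fix i and s1 :: state
  assume "(\<forall>x. x \<noteq> ''i'' \<longrightarrow> vars s1 x = vars s x) \<and>
     arrays s1 = arrays s \<and> printed s1 = printed s @ map (arrays s ''M'') [0..<i]"
    "vars s1 ''i'' = i" "vars s1 ''m'' = m"
  then show "ensures ang 1 (Print (Elem ''M'' (Var ''i''))) s1
     (\<lambda>s2. vars s2 ''i'' = i \<and> vars s2 ''m'' = m \<and>
       ((\<forall>x. x \<noteq> ''i'' \<longrightarrow> vars (s2\<lparr>vars := (vars s2)(''i'' := Suc i)\<rparr>) x = vars s x) \<and>
        arrays (s2\<lparr>vars := (vars s2)(''i'' := Suc i)\<rparr>) = arrays s \<and>
        printed (s2\<lparr>vars := (vars s2)(''i'' := Suc i)\<rparr>) = printed s @ map (arrays s ''M'') [0..<Suc i]))"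
    by (intro ensures_Print) simp_all
qed simp_all

text \<open>
  An addition of an edge outside the set is the triple that repeats this edge.
\<close>

definition add_guardC :: cond where
  "add_guardC = Both (Both (EqC (Var ''a'') (Var ''b'')) (EqC (Var ''b'') (Var ''c'')))
     (Less (Elem ''M'' (Var ''a'')) (Const 1))"

definition swap_guardC :: cond where
  "swap_guardC = Both (Both (Less (Const 0) (Elem ''M'' (Var ''a''))) (Less (Elem ''M'' (Var ''b'')) (Const 1)))
     (Both (Less (Elem ''M'' (Var ''c'')) (Const 1)) (Negate (EqC (Var ''b'') (Var ''c''))))"

definition add_guard :: "(nat \<Rightarrow> nat) \<Rightarrow> nat \<Rightarrow> nat \<Rightarrow> nat \<Rightarrow> bool" where
  "add_guard M a b c \<longleftrightarrow> a = b \<and> b = c \<and> M a = 0"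

definition swap_guard :: "(nat \<Rightarrow> nat) \<Rightarrow> nat \<Rightarrow> nat \<Rightarrow> nat \<Rightarrow> bool" where
  "swap_guard M a b c \<longleftrightarrow> 0 < M a \<and> M b = 0 \<and> M c = 0 \<and> b \<noteq> c"

lemma add_guardC_iff: "cond_val add_guardC s \<longleftrightarrow> add_guard (arrays s ''M'') (vars s ''a'') (vars s ''b'') (vars s ''c'')"
  by (auto simp: add_guardC_def add_guard_def)

lemma swap_guardC_iff: "cond_val swap_guardC s \<longleftrightarrow> swap_guard (arrays s ''M'') (vars s ''a'') (vars s ''b'') (vars s ''c'')"
  by (auto simp: swap_guardC_def swap_guard_def)

definition iterate :: com where
  "iterate = Seq (Assign ''chg'' (Const 0)) (Seq (phase add_guardC) (Seq (phase swap_guardC) print_set))"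

definition iterate_time :: "nat \<Rightarrow> nat" where
  "iterate_time L = 2 * phase_time L + for_time L 1 + 4"

definition search :: com where
  "search = Seq (Assign ''chg'' (Const 1)) (While (Less (Const 0) (Var ''chg'')) iterate)"

definition search_time :: "nat \<Rightarrow> nat" where
  "search_time L = (L + 1) * (iterate_time L + 3) + 4"

section \<open>The program performs Local Search\<close>

locale encoded_graph = graph G for G :: "'a graph" +
  fixes vs :: "'a list" and es :: "(nat \<times> nat) list"
  assumes enc: "encodes vs es G"
begin

abbreviation "m \<equiv> length es"
abbreviation "el \<equiv> edge_list vs es"

lemma length_el [simp]: "length el = m"
  by (simp add: edge_list_def)

lemma el_in: "k < m \<Longrightarrow> el ! k \<in> edges G"
  using enc unfolding encodes_def by (metis length_el nth_mem)

lemma edges_el: "e \<in> edges G \<Longrightarrow> \<exists>k<m. e = el ! k"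
  using enc unfolding encodes_def by (metis length_el in_set_conv_nth)

lemma el_eq_iff: "i < m \<Longrightarrow> j < m \<Longrightarrow> el ! i = el ! j \<longleftrightarrow> i = j"
  using enc unfolding encodes_def by (metis length_el nth_eq_iff_index_eq)

lemma card_edges: "card (edges G) = m"
  using enc unfolding encodes_def by (metis length_el distinct_card)

definition vec :: "'a set set \<Rightarrow> nat \<Rightarrow> nat" where
  "vec S = (\<lambda>i. if i < m \<and> el ! i \<in> S then 1 else 0)"

text \<open>
  The state \<open>s\<close> represents the edge set \<open>S\<close>: everything the program relies on between its phases.
\<close>

definition repr :: "'a set set \<Rightarrow> state \<Rightarrow> bool" where
  "repr S s \<longleftrightarrow> S \<subseteq> edges G \<and> vars s ''m'' = m \<and> arrays s ''M'' = vec S \<and>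
     (\<forall>k<m. arrays s ''src'' k = fst (es ! k) \<and> arrays s ''tgt'' k = snd (es ! k))"

fun move :: "'a set set \<Rightarrow> nat \<times> nat \<times> nat \<Rightarrow> 'a set set" where
  "move S (a, b, c) = (S - {el ! a}) \<union> {el ! b, el ! c}"

lemma touch_iff:
  assumes "repr S s" "k < m" "i < m"
  shows "touch (arrays s) k i \<longleftrightarrow> el ! k \<inter> el ! i \<noteq> {}"
proof -
  have nth: "vs ! p = vs ! q \<longleftrightarrow> p = q" if "p < length vs" "q < length vs" for p q
    using enc that by (simp add: encodes_def nth_eq_iff_index_eq)
  have b: "fst (es ! j) < length vs" "snd (es ! j) < length vs" if "j < m" for j
    using enc that nth_mem[OF that] by (auto simp: encodes_def split_beta)
  have el: "el ! j = {vs ! fst (es ! j), vs ! snd (es ! j)}" if "j < m" for j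
    using that by (simp add: edge_list_def split_beta)
  show ?thesis using assms by (auto simp: touch_def repr_def el b nth)
qed

text \<open>
  A propositional step, stated for an arbitrary relation to keep the set operations out of it.
\<close>

lemma clash_not_pairwise:
  "(\<exists>e\<in>U. \<exists>f\<in>U. \<exists>h\<in>E. e \<noteq> f \<and> A h e \<and> A h f) \<longleftrightarrow>
     \<not> (\<forall>e\<in>U. \<forall>f\<in>U. \<forall>h\<in>E. A h e \<longrightarrow> A h f \<longrightarrow> e = f)"
  by blast

lemma clash_iff:
  assumes s: "repr S s" and abc: "a < m" "b < m" "c < m"
  shows "clash (arrays s) m a b c \<longleftrightarrow> \<not> induced_matching G (move S (a, b, c))"
proof -
  have S: "S \<subseteq> edges G" and M: "arrays s ''M'' = vec S" using s by (simp_all add: repr_def)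
  let ?U = "move S (a, b, c)"
  have U: "?U \<subseteq> edges G" using S abc el_in by auto
  have picked: "picked (arrays s ''M'') a b c i \<longleftrightarrow> el ! i \<in> ?U" if "i < m" for i
    using that abc by (auto simp: picked_def M vec_def el_eq_iff)
  have exE: "(\<exists>e\<in>edges G. P e) \<longleftrightarrow> (\<exists>k<m. P (el ! k))" for P
    using edges_el el_in by blast
  have exU: "(\<exists>e\<in>?U. P e) \<longleftrightarrow> (\<exists>k<m. el ! k \<in> ?U \<and> P (el ! k))" for P
    using edges_el U by blast
  have "clash (arrays s) m a b c \<longleftrightarrow> (\<exists>i<m. \<exists>j<m. \<exists>k<m. el ! i \<in> ?U \<and> el ! j \<in> ?U \<and> el ! i \<noteq> el ! j \<and>
      el ! k \<inter> el ! i \<noteq> {} \<and> el ! k \<inter> el ! j \<noteq> {})"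
    unfolding clash_def by (simp add: picked touch_iff[OF s] el_eq_iff cong: conj_cong)
  also have "\<dots> \<longleftrightarrow> (\<exists>e\<in>?U. \<exists>f\<in>?U. \<exists>h\<in>edges G. e \<noteq> f \<and> h \<inter> e \<noteq> {} \<and> h \<inter> f \<noteq> {})"
    unfolding exU exE by blast
  finally show ?thesis
    using U clash_not_pairwise[of ?U "edges G" "\<lambda>h e. h \<inter> e \<noteq> {}"]
    by (simp only: induced_matching_iff simp_thms)
qed

lemma vec_move:
  assumes "a < m" "b < m" "c < m"
  shows "(vec S)(a := 0, b := 1, c := 1) = vec (move S (a, b, c))"
  using assms by (auto simp: vec_def el_eq_iff fun_eq_iff)

lemma cands_iff:
  assumes "repr S s"
  shows "(a, b, c) \<in> cands Gp (arrays s) m \<longleftrightarrow>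
     a < m \<and> b < m \<and> c < m \<and> Gp (vec S) a b c \<and> induced_matching G (move S (a, b, c))"
  using assms clash_iff[OF assms] by (auto simp: cands_def repr_def simp del: move.simps)

text \<open>
  The common form of \<open>add_step\<close> and \<open>swap_step\<close> in terms of triples of edge positions.
\<close>

definition phase_step :: "((nat \<Rightarrow> nat) \<Rightarrow> nat \<Rightarrow> nat \<Rightarrow> nat \<Rightarrow> bool) \<Rightarrow> 'a set set \<Rightarrow> 'a set set \<Rightarrow> bool" where
  "phase_step Gp S S' \<longleftrightarrow> (let C = move S ` {(a, b, c). a < m \<and> b < m \<and> c < m \<and> Gp (vec S) a b c \<and>
      induced_matching G (move S (a, b, c))} in if C = {} then S' = S else S' \<in> C)"

lemma add_step_iff:
  assumes "S \<subseteq> edges G"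
  shows "add_step G S S' \<longleftrightarrow> phase_step add_guard S S'"
proof -
  have "{S \<union> {e} | e. e \<in> edges G - S \<and> induced_matching G (S \<union> {e})} =
    move S ` {(a, b, c). a < m \<and> b < m \<and> c < m \<and> add_guard (vec S) a b c \<and>
      induced_matching G (move S (a, b, c))}" (is "?L = ?R")
  proof (intro set_eqI iffI)
    fix X assume "X \<in> ?L"
    then obtain e where e: "X = S \<union> {e}" "e \<in> edges G" "e \<notin> S" "induced_matching G (S \<union> {e})" by blast
    then obtain k where k: "k < m" "e = el ! k" using edges_el by blast
    then have "move S (k, k, k) = S \<union> {e}" using e by auto
    moreover have "add_guard (vec S) k k k" using k e by (simp add: add_guard_def vec_def)
    ultimately show "X \<in> ?R" using e k
      by (intro image_eqI[of _ _ "(k, k, k)"]) (simp_all del: move.simps)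
  next
    fix X assume "X \<in> ?R"
    then obtain a b c where abc: "a < m" "add_guard (vec S) a b c" "induced_matching G (move S (a, b, c))"
      "X = move S (a, b, c)" by blast
    then have "b = a" "c = a" "el ! a \<notin> S" by (auto simp: add_guard_def vec_def split: if_splits)
    then have "move S (a, b, c) = S \<union> {el ! a}" by auto
    then have "X = S \<union> {el ! a}" "induced_matching G (S \<union> {el ! a})" using abc by simp_all
    then show "X \<in> ?L" using el_in[OF \<open>a < m\<close>] \<open>el ! a \<notin> S\<close> by blast
  qed
  then show ?thesis by (simp add: add_step_def phase_step_def Let_def)
qed

lemma swap_step_iff:
  assumes "S \<subseteq> edges G"
  shows "swap_step G S S' \<longleftrightarrow> phase_step swap_guard S S'"
proof -
  have "{(S - {e}) \<union> {e', e''} | e e' e''.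
      e \<in> S \<and> e' \<in> edges G - S \<and> e'' \<in> edges G - S \<and> e' \<noteq> e'' \<and>
      induced_matching G ((S - {e}) \<union> {e', e''})} =
    move S ` {(a, b, c). a < m \<and> b < m \<and> c < m \<and> swap_guard (vec S) a b c \<and>
      induced_matching G (move S (a, b, c))}" (is "?L = ?R")
  proof (intro set_eqI iffI)
    fix X assume "X \<in> ?L"
    then obtain e e' e'' where e: "X = (S - {e}) \<union> {e', e''}" "e \<in> S" "e' \<in> edges G" "e' \<notin> S"
      "e'' \<in> edges G" "e'' \<notin> S" "e' \<noteq> e''" "induced_matching G ((S - {e}) \<union> {e', e''})" by blast
    then obtain a b c where k: "a < m" "e = el ! a" "b < m" "e' = el ! b" "c < m" "e'' = el ! c"
      using edges_el assms by (metis subsetD)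
    then have "move S (a, b, c) = X" using e by auto
    moreover have "swap_guard (vec S) a b c" using k e by (auto simp: swap_guard_def vec_def)
    ultimately show "X \<in> ?R" using e k
      by (intro image_eqI[of _ _ "(a, b, c)"]) (simp_all del: move.simps)
  next
    fix X assume "X \<in> ?R"
    then obtain a b c where abc: "a < m" "b < m" "c < m" "swap_guard (vec S) a b c"
      "induced_matching G (move S (a, b, c))" "X = move S (a, b, c)" by blast
    then have "el ! a \<in> S" "el ! b \<notin> S" "el ! c \<notin> S" "el ! b \<noteq> el ! c"
      by (auto simp: swap_guard_def vec_def el_eq_iff split: if_splits)
    then show "X \<in> ?L" using abc el_in unfolding move.simps by blast
  qed
  then show ?thesis by (simp add: swap_step_def phase_step_def Let_def)
qed

lemma phase_step_subset: "phase_step Gp S S' \<Longrightarrow> S \<subseteq> edges G \<Longrightarrow> S' \<subseteq> edges G"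
  by (auto simp: phase_step_def Let_def induced_matching_def split: if_splits)

text \<open>
  For angelic choices the prescribed result \<open>T\<close> of the step is reached. Every admissible triple enlarges the set, so
  \<open>chg\<close> records precisely whether its size grew.
\<close>

lemma ensures_phase_step:
  assumes s: "repr S s" and L: "m \<le> L"
    and g: "\<And>s. cond_val g s \<longleftrightarrow> Gp (arrays s ''M'') (vars s ''a'') (vars s ''b'') (vars s ''c'')"
    and card: "\<And>t. t \<in> cands Gp (arrays s) m \<Longrightarrow> card S < card (move S t)"
    and target: "ang \<Longrightarrow> phase_step Gp S T"
  shows "ensures ang (phase_time L) (phase g) s (\<lambda>s'. \<exists>S'. phase_step Gp S S' \<and> (ang \<longrightarrow> S' = T) \<and>
     repr S' s' \<and> printed s' = printed s \<and> vars s' ''chg'' = (if card S < card S' then 1 else vars s ''chg''))"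
proof -
  define C where "C = cands Gp (arrays s) m"
  have C: "C = {(a, b, c). a < m \<and> b < m \<and> c < m \<and> Gp (vec S) a b c \<and> induced_matching G (move S (a, b, c))}"
    using cands_iff[OF s] by (auto simp: C_def simp del: move.simps)
  have step: "phase_step Gp S S' \<longleftrightarrow> (if C = {} then S' = S else \<exists>t\<in>C. S' = move S t)" for S'
    unfolding phase_step_def Let_def C[symmetric] image_is_empty image_iff by (rule refl)
  \<comment> \<open>the triples that lead to the prescribed set; all triples if the choices are demonic\<close>
  define W where "W = {t. ang \<longrightarrow> move S t = T}"
  have m: "vars s ''m'' = m" using s by (simp add: repr_def)
  have "if ang then C \<noteq> {} \<longrightarrow> C \<inter> W \<noteq> {} else C \<subseteq> W"
  proof (cases ang)
    case True
    have "C \<inter> W \<noteq> {}" if "C \<noteq> {}"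
    proof -
      obtain t where "t \<in> C" "T = move S t" using target[OF True] \<open>C \<noteq> {}\<close> unfolding step by auto
      then have "t \<in> C \<inter> W" by (simp add: W_def)
      then show ?thesis by blast
    qed
    then show ?thesis using True by simp
  qed (simp add: W_def)
  note ph = ensures_phase[OF m L g this[unfolded C_def], folded C_def]
  show ?thesis
  proof (rule ensures_mono[OF ph order_refl], elim conjE)
    fix s' assume fr: "frame scratch scratch_arrays s s'"
      and eff: "if C = {} then arrays s' ''M'' = arrays s ''M'' \<and> vars s' ''chg'' = vars s ''chg''
        else vars s' ''chg'' = 1 \<and>
          (\<exists>(a, b, c)\<in>C \<inter> W. arrays s' ''M'' = (arrays s ''M'')(a := 0, b := 1, c := 1))"
    have same: "vars s' ''m'' = m" "printed s' = printed s"
      "\<forall>k<m. arrays s' ''src'' k = fst (es ! k) \<and> arrays s' ''tgt'' k = snd (es ! k)"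
      using s frame_vars[OF fr] frame_arrays[OF fr] frame_printed[OF fr] by (simp_all add: repr_def)
    show "\<exists>S'. phase_step Gp S S' \<and> (ang \<longrightarrow> S' = T) \<and> repr S' s' \<and> printed s' = printed s \<and>
       vars s' ''chg'' = (if card S < card S' then 1 else vars s ''chg'')"
    proof (cases "C = {}")
      case True
      then have "repr S s'" using eff same s by (simp add: repr_def)
      then show ?thesis using True eff same target step by auto
    next
      case False
      then obtain a b c where abc: "(a, b, c) \<in> C" "(a, b, c) \<in> W"
        "arrays s' ''M'' = (arrays s ''M'')(a := 0, b := 1, c := 1)" using eff by auto
      have lt: "a < m" "b < m" "c < m" using abc(1) by (auto simp: C)
      have ps: "phase_step Gp S (move S (a, b, c))" 
        unfolding step if_not_P[OF False] using abc(1) by blast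
      have "arrays s' ''M'' = vec (move S (a, b, c))"
        using abc(3) s vec_move[OF lt] by (simp add: repr_def del: move.simps)
      then have "repr (move S (a, b, c)) s'"
        using same s phase_step_subset[OF ps] by (simp add: repr_def del: move.simps)
      then show ?thesis
        using ps abc(1,2) eff False same card[of "(a, b, c)"]
        by (intro exI[of _ "move S (a, b, c)"]) (simp add: C_def W_def del: move.simps)
    qed
  qed
qed

lemma card_move_add:
  assumes "repr S s" "t \<in> cands add_guard (arrays s) m"
  shows "card S < card (move S t)"
proof -
  obtain a b c where t: "t = (a, b, c)" by (cases t)
  have a: "a = b" "b = c" "a < m" "el ! a \<notin> S"
    using assms(2) cands_iff[OF assms(1), of a b c] by (auto simp: t add_guard_def vec_def simp del: move.simps split: if_splits)
  have "finite S" using assms(1) finite_edges finite_subset by (auto simp: repr_def)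
  moreover have "move S t = insert (el ! a) S" using a t by auto
  ultimately show ?thesis using a by simp
qed

lemma card_move_swap:
  assumes "repr S s" "t \<in> cands swap_guard (arrays s) m"
  shows "card S < card (move S t)"
proof -
  obtain a b c where t: "t = (a, b, c)" by (cases t)
  have abc: "a < m" "b < m" "c < m" "el ! a \<in> S" "el ! b \<notin> S" "el ! c \<notin> S" "b \<noteq> c"
    using assms(2) cands_iff[OF assms(1), of a b c]
    by (auto simp: t swap_guard_def vec_def simp del: move.simps split: if_splits)
  have "finite S" using assms(1) finite_edges finite_subset by (auto simp: repr_def)
  moreover have "el ! b \<noteq> el ! c" using abc el_eq_iff by simp
  ultimately show ?thesis using abc card_remove_insert2 by (simp add: t)
qed

lemma add_step_card:
  assumes "add_step G S S'" "S \<subseteq> edges G"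
  shows "S' = S \<or> card S < card S'"
  using assms(1)
proof (cases rule: add_step_cases)
  case (2 f)
  then show ?thesis using finite_subset[OF assms(2) finite_edges] by simp
qed simp

lemma swap_step_card:
  assumes "swap_step G S S'" "S \<subseteq> edges G"
  shows "S' = S \<or> card S < card S'"
  using assms(1)
proof (cases rule: swap_step_cases)
  case (2 e f f')
  then show ?thesis
    using card_remove_insert2[OF finite_subset[OF assms(2) finite_edges]] by simp
qed simp

lemma ensures_iterate:
  assumes s: "repr S s" and L: "m \<le> L" and target: "ang \<Longrightarrow> iteration G S T"
  shows "ensures ang (iterate_time L) iterate s (\<lambda>s'. \<exists>S'. iteration G S S' \<and> (ang \<longrightarrow> S' = T) \<and>
     repr S' s' \<and> printed s' = printed s @ map (vec S') [0..<m] \<and>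
     vars s' ''chg'' = (if card S < card S' then 1 else 0))"
proof -
  have S: "S \<subseteq> edges G" using s by (simp add: repr_def)
  obtain T1 where T1: "ang \<Longrightarrow> add_step G S T1 \<and> swap_step G T1 T"
    using target by (auto simp: iteration_def)
  let ?Q = "\<lambda>s' :: state. \<exists>S'. iteration G S S' \<and> (ang \<longrightarrow> S' = T) \<and>
     repr S' s' \<and> printed s' = printed s @ map (vec S') [0..<m] \<and>
     vars s' ''chg'' = (if card S < card S' then 1 else 0)"
  let ?s0 = "s\<lparr>vars := (vars s)(''chg'' := exp_val (Const 0) s)\<rparr>"
  have s0: "repr S ?s0" using s by (simp add: repr_def)
  have "ensures ang (phase_time L) (phase add_guardC) ?s0
     (\<lambda>s1. ensures ang (phase_time L + for_time L 1 + 1) (Seq (phase swap_guardC) print_set) s1 ?Q)"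
  proof (rule ensures_mono[OF ensures_phase_step[OF s0 L add_guardC_iff, of ang T1] order_refl])
    show "\<And>t. t \<in> cands add_guard (arrays ?s0) m \<Longrightarrow> card S < card (move S t)"
      using card_move_add[OF s0] .
    show "ang \<Longrightarrow> phase_step add_guard S T1" using T1 add_step_iff[OF S] by simp
    fix s1 assume "\<exists>S1. phase_step add_guard S S1 \<and> (ang \<longrightarrow> S1 = T1) \<and> repr S1 s1 \<and>
       printed s1 = printed ?s0 \<and> vars s1 ''chg'' = (if card S < card S1 then 1 else vars ?s0 ''chg'')"
    then obtain S1 where add: "add_step G S S1" and T1': "ang \<longrightarrow> S1 = T1" and s1: "repr S1 s1"
      and p1: "printed s1 = printed s" and chg1: "vars s1 ''chg'' = (if card S < card S1 then 1 else 0)"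
      using add_step_iff[OF S] by auto
    have S1: "S1 \<subseteq> edges G" using s1 by (simp add: repr_def)
    show "ensures ang (phase_time L + for_time L 1 + 1) (Seq (phase swap_guardC) print_set) s1 ?Q"
    proof (intro ensures_Seq, rule ensures_mono[OF ensures_phase_step[OF s1 L swap_guardC_iff, of ang T] order_refl])
      show "\<And>t. t \<in> cands swap_guard (arrays s1) m \<Longrightarrow> card S1 < card (move S1 t)"
        using card_move_swap[OF s1] .
      show "ang \<Longrightarrow> phase_step swap_guard S1 T" using T1 T1' swap_step_iff[OF S1] by simp
      fix s2 assume "\<exists>S2. phase_step swap_guard S1 S2 \<and> (ang \<longrightarrow> S2 = T) \<and> repr S2 s2 \<and>
         printed s2 = printed s1 \<and> vars s2 ''chg'' = (if card S1 < card S2 then 1 else vars s1 ''chg'')"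
      then obtain S2 where swap: "swap_step G S1 S2" and T2: "ang \<longrightarrow> S2 = T" and s2: "repr S2 s2"
        and p2: "printed s2 = printed s" and chg2: "vars s2 ''chg'' = (if card S1 < card S2 then 1 else vars s1 ''chg'')"
        using swap_step_iff[OF S1] p1 by auto
      have it: "iteration G S S2" using add swap by (auto simp: iteration_def)
      have chg: "vars s2 ''chg'' = (if card S < card S2 then 1 else 0)"
        using chg1 chg2 add_step_card[OF add S] swap_step_card[OF swap S1] by auto
      have m2: "vars s2 ''m'' = m" using s2 by (simp add: repr_def)
      show "ensures ang (for_time L 1) print_set s2 ?Q"
      proof (rule ensures_mono[OF ensures_print_set[OF m2 L] order_refl], elim conjE)
        fix s3 :: state assume s3: "\<forall>x. x \<noteq> ''i'' \<longrightarrow> vars s3 x = vars s2 x" "arrays s3 = arrays s2"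
          "printed s3 = printed s2 @ map (arrays s2 ''M'') [0..<m]"
        have "repr S2 s3" "arrays s2 ''M'' = vec S2" using s2 s3 by (simp_all add: repr_def)
        then show "?Q s3" using it T2 chg s3 p2 by (intro exI[of _ S2]) simp
      qed
    qed
  qed
  then have "ensures ang (1 + (phase_time L + (phase_time L + for_time L 1 + 1) + 1) + 1) iterate s ?Q"
    unfolding iterate_def by (intro ensures_Seq ensures_Assign) simp_all
  then show ?thesis by (rule ensures_mono) (simp add: iterate_time_def, assumption)
qed

lemma map_vec: "map (vec S) [0..<m] = map (\<lambda>e. if e \<in> S then 1 else 0) el"
  by (rule nth_equalityI) (simp_all add: vec_def)

text \<open>
  The size of the set grows in each round but the last and never exceeds \<open>m\<close>, which bounds the
  number of rounds. For angelic choices the prescribed run \<open>Ts\<close> tells which set to reach next.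
\<close>

lemma ensures_loop:
  assumes "repr S s" "m \<le> L" "0 < vars s ''chg''" "ang \<Longrightarrow> ls_run G S Ts"
  shows "ensures ang ((m - card S + 1) * (iterate_time L + 3) + 2) (While (Less (Const 0) (Var ''chg'')) iterate) s
    (\<lambda>s'. \<exists>Ms. ls_run G S Ms \<and> (ang \<longrightarrow> Ms = Ts) \<and> printed s' = printed s @ transcript el Ms)"
  using assms(1,3,4)
proof (induction "m - card S" arbitrary: S s Ts rule: less_induct)
  case less
  let ?W = "While (Less (Const 0) (Var ''chg'')) iterate"
  let ?Q = "\<lambda>s' :: state. \<exists>Ms. ls_run G S Ms \<and> (ang \<longrightarrow> Ms = Ts) \<and> printed s' = printed s @ transcript el Ms"
  let ?t = "(m - card S) * (iterate_time L + 3) + 2"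
  \<comment> \<open>the next set of the prescribed run\<close>
  define T where "T = hd Ts"
  have T: "iteration G S T" "if card S < card T then Ts = T # tl Ts \<and> ls_run G T (tl Ts) else Ts = [T]" if ang
    using less.prems(3)[OF that] by (auto simp: T_def elim: ls_run.cases)
  have "ensures ang (iterate_time L) iterate s (\<lambda>s1. ensures ang ?t ?W s1 ?Q)"
  proof (rule ensures_mono[OF ensures_iterate[OF less.prems(1) assms(2) T(1)] order_refl], assumption)
    fix s1 assume "\<exists>S'. iteration G S S' \<and> (ang \<longrightarrow> S' = T) \<and>
     repr S' s1 \<and> printed s1 = printed s @ map (vec S') [0..<m] \<and>
     vars s1 ''chg'' = (if card S < card S' then 1 else 0)"
    then obtain S' where S': "iteration G S S'" "ang \<longrightarrow> S' = T" "repr S' s1"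
      "printed s1 = printed s @ map (vec S') [0..<m]" "vars s1 ''chg'' = (if card S < card S' then 1 else 0)"
      by blast
    show "ensures ang ?t ?W s1 ?Q"
    proof (cases "card S < card S'")
      case False
      then have "ls_run G S [S']" using S'(1) by (intro ls_run.stop)
      moreover have "ang \<longrightarrow> [S'] = Ts" using T(2) S'(2) False by auto
      ultimately have "?Q s1" using S' by (intro exI[of _ "[S']"]) (simp add: transcript_def map_vec)
      then show ?thesis using False S'(5) by (intro ensures_While) simp_all
    next
      case True
      have "card S' \<le> m"
        using S'(3) card_edges card_mono[OF finite_edges, of S'] by (simp add: repr_def)
      then have lt: "m - card S' < m - card S" using True by simp
      have run: "ang \<Longrightarrow> ls_run G S' (tl Ts)" using T(2) S'(2) True by auto
      have "ensures ang ((m - card S' + 1) * (iterate_time L + 3) + 2) ?W s1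
        (\<lambda>s'. \<exists>Ms. ls_run G S' Ms \<and> (ang \<longrightarrow> Ms = tl Ts) \<and> printed s' = printed s1 @ transcript el Ms)"
        by (rule less.hyps[OF lt S'(3) _ run]) (use True S'(5) in simp_all)
      then show ?thesis
      proof (rule ensures_mono)
        have "m - card S' + 1 \<le> m - card S" using lt by simp
        then show "(m - card S' + 1) * (iterate_time L + 3) + 2 \<le> ?t"
          using mult_le_mono1 add_le_mono1 by blast
        fix s' :: state assume "\<exists>Ms. ls_run G S' Ms \<and> (ang \<longrightarrow> Ms = tl Ts) \<and> printed s' = printed s1 @ transcript el Ms"
        then obtain Ms where Ms: "ls_run G S' Ms" "ang \<longrightarrow> Ms = tl Ts" "printed s' = printed s1 @ transcript el Ms"
          by blast
        have "ls_run G S (S' # Ms)" using S'(1) True Ms(1) by (rule ls_run.continue)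
        moreover have "ang \<longrightarrow> S' # Ms = Ts" using T(2) S'(2) True Ms(2) by auto
        ultimately show "?Q s'" using Ms(3) S'(4)
          by (intro exI[of _ "S' # Ms"]) (simp add: transcript_def map_vec)
      qed
    qed
  qed
  from ensures_Seq[OF this]
  have "ensures ang ((iterate_time L + ?t + 1) + 2) ?W s ?Q"
    by (rule ensures_While) (use less.prems(2) in simp_all)
  then show ?case by (rule ensures_mono) (simp, assumption)
qed

text \<open>
  With demonic choices this gives halting and that only transcripts of runs are printed; with
  angelic choices, that the transcript of every run \<open>Ts\<close> is printed by some execution.
\<close>

lemma ensures_search:
  assumes L: "m \<le> L" and target: "ang \<Longrightarrow> ls_run G {} Ts"
  shows "ensures ang (search_time L) search (input_state vs es)
    (\<lambda>s'. \<exists>Ms. ls_run G {} Ms \<and> (ang \<longrightarrow> Ms = Ts) \<and> printed s' = transcript el Ms)"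
proof -
  let ?s = "input_state vs es"
  let ?s' = "?s\<lparr>vars := (vars ?s)(''chg'' := exp_val (Const 1) ?s)\<rparr>"
  have repr: "repr {} ?s'" by (simp add: repr_def input_state_def vec_def)
  have "ensures ang (1 + ((m - card ({} :: 'a set set) + 1) * (iterate_time L + 3) + 2) + 1) search ?s
    (\<lambda>s'. \<exists>Ms. ls_run G {} Ms \<and> (ang \<longrightarrow> Ms = Ts) \<and> printed s' = printed ?s' @ transcript el Ms)"
    unfolding search_def
    by (intro ensures_Seq ensures_Assign ensures_loop[OF repr L _ target]) simp_all
  then show ?thesis
  proof (rule ensures_mono)
    have "(m + 1) * (iterate_time L + 3) \<le> (L + 1) * (iterate_time L + 3)" using L by simp
    then show "1 + ((m - card ({} :: 'a set set) + 1) * (iterate_time L + 3) + 2) + 1 \<le> search_time L"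
      by (simp add: search_time_def)
  qed (simp add: input_state_def)
qed

end

definition is_poly :: "(nat \<Rightarrow> nat) \<Rightarrow> bool" where
  "is_poly f \<longleftrightarrow> (\<exists>p. \<forall>x. poly p x = f x)"

lemma is_poly_const: "is_poly (\<lambda>x. c)"
  unfolding is_poly_def by (rule exI[of _ "[:c:]"]) simp

lemma is_poly_id: "is_poly (\<lambda>x. x)"
  unfolding is_poly_def by (rule exI[of _ "[:0, 1:]"]) simp

lemma is_poly_add: "is_poly f \<Longrightarrow> is_poly g \<Longrightarrow> is_poly (\<lambda>x. f x + g x)"
  unfolding is_poly_def by (metis poly_add)

lemma is_poly_mult: "is_poly f \<Longrightarrow> is_poly g \<Longrightarrow> is_poly (\<lambda>x. f x * g x)"
  unfolding is_poly_def by (metis poly_mult)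

lemma is_poly_search_time: "is_poly search_time"
  unfolding search_time_def[abs_def] iterate_time_def phase_time_def collect_time_def check_time_def for_time_def
  by (intro is_poly_add is_poly_mult is_poly_const is_poly_id)

theorem local_search_poly_time_simple: "local_search_poly_time {G :: 'a graph. simple_graph G}"
proof -
  obtain p where p: "\<And>x. poly p x = search_time x" using is_poly_search_time by (auto simp: is_poly_def)
  have "halts_within search (input_state vs es) (poly p (length vs + length es)) \<and>
        outputs search (input_state vs es) = {transcript (edge_list vs es) Ms | Ms. ls_run G {} Ms}"
    if "simple_graph G" "encodes vs es G" for G :: "'a graph" and vs es
  proof -
    interpret encoded_graph G vs es using that by unfold_locales
    let ?L = "length vs + length es"
    have L: "m \<le> ?L" by simp
    note demonic = ensures_search[OF L, of False]
    have "halts_within search (input_state vs es) (poly p ?L)"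
      unfolding p by (rule ensures_demonic_halts[OF demonic]) simp
    moreover have "outputs search (input_state vs es) \<subseteq> {transcript el Ms | Ms. ls_run G {} Ms}"
      using ensures_demonic_final[OF demonic] by (auto simp: outputs_def)
    moreover have "transcript el Ms \<in> outputs search (input_state vs es)" if run: "ls_run G {} Ms" for Ms
    proof -
      obtain s' where "step\<^sup>*\<^sup>* (search, input_state vs es) (Skip, s')" "printed s' = transcript el Ms"
        using ensures_angelic_final[OF ensures_search[OF L, of True Ms]] run by auto
      then show ?thesis unfolding outputs_def by (metis (mono_tags, lifting) mem_Collect_eq)
    qed
    ultimately show ?thesis by auto
  qed
  then show ?thesis unfolding local_search_poly_time_def by blast
qed

section \<open>Conflicts and private edges of a locally optimal matching\<close>

context graph
begin

definition conflict :: "'a set \<Rightarrow> 'a set \<Rightarrow> bool" where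
  "conflict e f \<longleftrightarrow> (\<exists>h\<in>edges G. h \<inter> e \<noteq> {} \<and> h \<inter> f \<noteq> {})"

lemma conflict_sym: "conflict e f \<Longrightarrow> conflict f e"
  by (auto simp: conflict_def)

lemma conflict_refl: "e \<in> edges G \<Longrightarrow> conflict e e"
  unfolding conflict_def by (rule bexI[of _ e]) (auto elim: edge_cases)

lemma induced_matching_conflict:
  "induced_matching G X \<longleftrightarrow> X \<subseteq> edges G \<and> (\<forall>e\<in>X. \<forall>f\<in>X. conflict e f \<longrightarrow> e = f)"
  unfolding induced_matching_iff conflict_def by blast

text \<open>
  The intersection with \<open>\<Union>(edges G)\<close> is needed because a common isolated vertex causes no conflict.
\<close>

lemma conflict_iff: "conflict {x, y} {z, w} \<longleftrightarrow>
    {x, y} \<inter> {z, w} \<inter> \<Union>(edges G) \<noteq> {} \<or> adj x z \<or> adj x w \<or> adj y z \<or> adj y w"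
proof
  assume "conflict {x, y} {z, w}"
  then obtain h p q where h: "h \<in> edges G" "p \<in> h" "p \<in> {x, y}" "q \<in> h" "q \<in> {z, w}"
    unfolding conflict_def by blast
  show "{x, y} \<inter> {z, w} \<inter> \<Union>(edges G) \<noteq> {} \<or> adj x z \<or> adj x w \<or> adj y z \<or> adj y w"
  proof (cases "p = q")
    case True
    then show ?thesis using h by blast
  next
    case False
    obtain r s where "h = {r, s}" using h(1) by (rule edge_cases)
    then have "h = {p, q}" using h False by auto
    then have "adj p q" using h by (simp add: adj_def)
    then show ?thesis using h by auto
  qed
next
  have *: "conflict {x, y} {z, w}" if "adj p q" "p \<in> {x, y}" "q \<in> {z, w}" for p q
    using that unfolding conflict_def adj_def by (intro bexI[of _ "{p, q}"]) auto
  assume "{x, y} \<inter> {z, w} \<inter> \<Union>(edges G) \<noteq> {} \<or> adj x z \<or> adj x w \<or> adj y z \<or> adj y w"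
  then consider p h where "p \<in> {x, y}" "p \<in> {z, w}" "p \<in> h" "h \<in> edges G"
    | "adj x z \<or> adj x w \<or> adj y z \<or> adj y w"
    by auto
  then show "conflict {x, y} {z, w}"
  proof cases
    case 1
    then show ?thesis unfolding conflict_def by (intro bexI[of _ h]) blast+
  next
    case 2
    then show ?thesis using * by auto
  qed
qed

definition private_to :: "'a set set \<Rightarrow> 'a set \<Rightarrow> 'a set set" where
  "private_to M e = {f \<in> edges G. \<forall>e'\<in>M. conflict e' f \<longleftrightarrow> e' = e}"

lemma induced_matching_insert:
  assumes X: "induced_matching G X" and f: "f \<in> edges G" and no: "\<And>e. e \<in> X \<Longrightarrow> \<not> conflict e f"
  shows "induced_matching G (insert f X)"
  unfolding induced_matching_conflict
proof (intro conjI ballI impI)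
  fix a b assume ab: "a \<in> insert f X" "b \<in> insert f X" "conflict a b"
  have "a = b" if "a \<in> X" "b \<in> X" using X that ab(3) by (simp add: induced_matching_conflict)
  then show "a = b" using ab no conflict_sym[OF ab(3)] by blast
qed (use X f in \<open>simp add: induced_matching_conflict\<close>)

lemma induced_matching_subset: "induced_matching G X \<Longrightarrow> Y \<subseteq> X \<Longrightarrow> induced_matching G Y"
  unfolding induced_matching_conflict by (meson subset_iff)

text \<open>
  Otherwise \<open>f\<close> could be added.
\<close>

lemma locally_optimal_covers:
  assumes M: "locally_optimal M" and f: "f \<in> edges G"
  shows "\<exists>e\<in>M. conflict e f"
proof (rule ccontr)
  assume no: "\<not> (\<exists>e\<in>M. conflict e f)"
  then have "f \<in> edges G - M" using f conflict_refl by blast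
  moreover have "induced_matching G (M \<union> {f})"
    using induced_matching_insert[of M f] M no f by (simp add: locally_optimal_def)
  ultimately show False using M unfolding locally_optimal_def by blast
qed

text \<open>
  Otherwise \<open>e\<close> could be swapped for \<open>f\<close> and \<open>f'\<close>: being private to \<open>e\<close>, they conflict with no other
  member of \<open>M\<close>.
\<close>

lemma locally_optimal_private_conflict:
  assumes M: "locally_optimal M" and e: "e \<in> M"
    and f: "f \<in> private_to M e" and f': "f' \<in> private_to M e"
  shows "conflict f f'"
proof (rule ccontr)
  assume no: "\<not> conflict f f'"
  have ff: "f \<in> edges G" "f' \<in> edges G"
    and pf: "\<And>e'. e' \<in> M \<Longrightarrow> conflict e' f \<longleftrightarrow> e' = e" and pf': "\<And>e'. e' \<in> M \<Longrightarrow> conflict e' f' \<longleftrightarrow> e' = e"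
    using f f' by (auto simp: private_to_def)
  have "f \<noteq> e" using pf'[OF e] no by auto
  have "f' \<noteq> e" using pf[OF e] no conflict_sym by auto
  have "f \<notin> M" using pf[of f] conflict_refl[OF ff(1)] \<open>f \<noteq> e\<close> by auto
  moreover have "f' \<notin> M" using pf'[of f'] conflict_refl[OF ff(2)] \<open>f' \<noteq> e\<close> by auto
  moreover have "f \<noteq> f'" using no conflict_refl[OF ff(1)] by auto
  moreover have "induced_matching G ((M - {e}) \<union> {f, f'})"
  proof -
    have "induced_matching G (M - {e})"
      using M induced_matching_subset[of M "M - {e}"] by (simp add: locally_optimal_def)
    then have "induced_matching G (insert f' (M - {e}))"
      using ff(2) pf' by (intro induced_matching_insert) auto
    then have "induced_matching G (insert f (insert f' (M - {e})))"
    proof (rule induced_matching_insert[OF _ ff(1)])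
      fix a assume "a \<in> insert f' (M - {e})"
      then show "\<not> conflict a f" using pf no conflict_sym by auto
    qed
    then show ?thesis by (simp add: insert_commute)
  qed
  ultimately show False using M e ff unfolding locally_optimal_def by blast
qed

text \<open>
  An edge in conflict with at least two members of \<open>M\<close> is counted at least twice in the first
  summands, and any other edge is private, hence counted once in the first and once in the
  second summands.
\<close>

lemma two_card_edges_le:
  assumes M: "locally_optimal M"
  shows "2 * card (edges G) \<le>
    (\<Sum>e\<in>M. card {f \<in> edges G. conflict e f} + card (private_to M e))"
proof -
  let ?E = "edges G"
  have fM: "finite M" using M induced_matching_finite unfolding locally_optimal_def by blast
  have two: "2 \<le> card {e \<in> M. conflict e f} + card {e \<in> M. f \<in> private_to M e}" if f: "f \<in> ?E" for f
  proof -
    obtain e where e: "e \<in> M" "conflict e f" using locally_optimal_covers[OF M f] by blast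
    show ?thesis
    proof (cases "\<exists>e'\<in>M. conflict e' f \<and> e' \<noteq> e")
      case True
      then obtain e' where "e' \<in> M" "conflict e' f" "e' \<noteq> e" by blast
      then have "card {e, e'} \<le> card {e \<in> M. conflict e f}"
        using e fM by (intro card_mono) auto
      then show ?thesis using \<open>e' \<noteq> e\<close> by simp
    next
      case False
      then have "\<forall>e'\<in>M. conflict e' f \<longleftrightarrow> e' = e" using e by metis
      then have "f \<in> private_to M e" using f by (simp add: private_to_def)
      then have "card {e} \<le> card {e \<in> M. conflict e f}" "card {e} \<le> card {e \<in> M. f \<in> private_to M e}"
        using e fM by (intro card_mono; auto)+
      then show ?thesis by simp
    qed
  qed
  have count: "(\<Sum>e\<in>M. card {f \<in> ?E. R e f}) = (\<Sum>f\<in>?E. card {e \<in> M. R e f})" for R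
  proof -
    have "(\<Sum>e\<in>M. card {f \<in> ?E. R e f}) = (\<Sum>e\<in>M. \<Sum>f\<in>?E. if R e f then 1 else 0)"
      by (simp add: sum.If_cases finite_edges Collect_conj_eq)
    also have "\<dots> = (\<Sum>f\<in>?E. \<Sum>e\<in>M. if R e f then 1 else 0)" by (rule sum.swap)
    also have "\<dots> = (\<Sum>f\<in>?E. card {e \<in> M. R e f})"
      by (simp add: sum.If_cases fM Collect_conj_eq)
    finally show ?thesis .
  qed
  have "2 * card ?E = (\<Sum>f\<in>?E. 2)" by simp
  also have "\<dots> \<le> (\<Sum>f\<in>?E. card {e \<in> M. conflict e f} + card {e \<in> M. f \<in> private_to M e})"
    by (intro sum_mono two)
  also have "\<dots> = (\<Sum>e\<in>M. card {f \<in> ?E. conflict e f} + card {f \<in> ?E. f \<in> private_to M e})"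
    by (simp add: sum.distrib count)
  also have "\<dots> = (\<Sum>e\<in>M. card {f \<in> ?E. conflict e f} + card (private_to M e))"
    by (intro sum.cong refl arg_cong2[where f = "(+)"] arg_cong[where f = card]) (auto simp: private_to_def)
  finally show ?thesis .
qed

end

section \<open>Edges near an edge of a regular graph\<close>

context graph
begin

lemma edges_at: "{e \<in> edges G. x \<in> e} = (\<lambda>y. {x, y}) ` nbrs x"
proof (intro set_eqI iffI)
  fix e assume "e \<in> {e \<in> edges G. x \<in> e}"
  then show "e \<in> (\<lambda>y. {x, y}) ` nbrs x"
    by (auto elim!: edge_through simp: nbrs_def)
qed (auto simp: nbrs_def adj_def)

lemma degree_of_eq: "degree_of G x = card (nbrs x)"
  unfolding degree_of_def edges_at
  by (rule card_image) (auto simp: inj_on_def doubleton_eq_iff)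

end

locale regular_graph = graph +
  fixes d :: nat
  assumes regular: "regular d G"
begin

lemma card_nbrs: "x \<in> verts G \<Longrightarrow> card (nbrs x) = d"
  using regular by (simp add: regular_def degree_of_eq)

lemma card_edges_at: "adj x y \<Longrightarrow> card {e \<in> edges G. x \<in> e} = d"
  using regular adj_verts[of x y] by (simp add: regular_def degree_of_def)

lemma card_edges_meeting_edge:
  assumes "e \<in> edges G"
  shows "card {h \<in> edges G. h \<inter> e \<noteq> {}} = 2 * d - 1"
proof -
  obtain x y where e: "e = {x, y}" "adj x y" "x \<noteq> y" using assms by (rule edge_cases)
  have "{h \<in> edges G. h \<inter> e \<noteq> {}} = {h \<in> edges G. x \<in> h} \<union> {h \<in> edges G. y \<in> h}"
    using e by auto
  moreover have "{h \<in> edges G. x \<in> h} \<inter> {h \<in> edges G. y \<in> h} = {e}"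
  proof (intro equalityI subsetI)
    fix h assume h: "h \<in> {h \<in> edges G. x \<in> h} \<inter> {h \<in> edges G. y \<in> h}"
    then have "h \<in> edges G" by simp
    then obtain p q where "h = {p, q}" by (rule edge_cases)
    then have "h = e" using h e by auto
    then show "h \<in> {e}" by simp
  qed (use e assms in auto)
  ultimately show ?thesis
    using card_Un_Int[of "{h \<in> edges G. x \<in> h}" "{h \<in> edges G. y \<in> h}"] finite_edges
      card_edges_at[OF e(2)] card_edges_at[OF adj_sym[OF e(2)]] by simp
qed

text \<open>
  No edge meets two members of \<open>X\<close>, so their stars are disjoint.
\<close>

lemma induced_matching_card_le:
  assumes X: "induced_matching G X"
  shows "card X * (2 * d - 1) \<le> card (edges G)"
proof -
  have sub: "X \<subseteq> edges G"
    and uniq: "\<And>e f h. e \<in> X \<Longrightarrow> f \<in> X \<Longrightarrow> h \<in> edges G \<Longrightarrow> h \<inter> e \<noteq> {} \<Longrightarrow> h \<inter> f \<noteq> {} \<Longrightarrow> e = f"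
    using X induced_matching_iff[of X] by blast+
  have fin: "finite X" using sub finite_edges finite_subset by blast
  let ?I = "\<lambda>e. {h \<in> edges G. h \<inter> e \<noteq> {}}"
  have "card X * (2 * d - 1) = (\<Sum>e\<in>X. card (?I e))"
    using sub card_edges_meeting_edge by (simp add: subset_iff)
  also have "\<dots> = card (\<Union>e\<in>X. ?I e)"
    by (rule card_UN_disjoint[symmetric]) (use fin finite_edges uniq in auto)
  also have "\<dots> \<le> card (edges G)"
    by (intro card_mono finite_edges) auto
  finally show ?thesis .
qed

lemma nu_s_le: "nu_s G * (2 * d - 1) \<le> card (edges G)"
proof -
  let ?I = "{M. induced_matching G M}"
  have "?I \<subseteq> Pow (edges G)" by (auto simp: induced_matching_def)
  then have "finite ?I" using finite_edges finite_subset by blast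
  moreover have "{} \<in> ?I" using induced_matching_iff[of "{}"] by simp
  ultimately have "nu_s G \<in> card ` ?I" unfolding nu_s_def by (intro Max_in) auto
  then show ?thesis using induced_matching_card_le by auto
qed

text \<open>
  For an edge \<open>{u, v}\<close> this contains \<open>u\<close> and \<open>v\<close>, and the edges meeting it are those in conflict with
  \<open>{u, v}\<close>. It consists of \<open>u\<close>, \<open>v\<close>, their common neighbours and the two sides \<open>side u v\<close> and \<open>side v u\<close>.
\<close>

definition near :: "'a \<Rightarrow> 'a \<Rightarrow> 'a set" where
  "near u v = nbrs u \<union> nbrs v"

definition side :: "'a \<Rightarrow> 'a \<Rightarrow> 'a set" where
  "side u v = nbrs u - insert v (nbrs v)"

text \<open>
  The set \<open>F\<close> will be the set of vertices out of reach of the other edges of the matching, so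
  that the edges inside \<open>F\<close> are the private ones.
\<close>

definition far :: "'a \<Rightarrow> 'a \<Rightarrow> 'a set \<Rightarrow> 'a set" where
  "far u v F = F - near u v"

definition links :: "'a \<Rightarrow> 'a \<Rightarrow> 'a set \<Rightarrow> 'a \<Rightarrow> nat" where
  "links u v F x = card (nbrs x \<inter> far u v F)"

text \<open>
  Local optimality provides this: an edge inside \<open>F\<close> avoiding \<open>near u v\<close> could be added.
\<close>

definition covered :: "'a \<Rightarrow> 'a \<Rightarrow> 'a set \<Rightarrow> bool" where
  "covered u v F \<longleftrightarrow> adj u v \<and> u \<in> F \<and> v \<in> F \<and>
     (\<forall>x\<in>F. \<forall>y\<in>F. adj x y \<longrightarrow> x \<in> near u v \<or> y \<in> near u v)"

lemma near_sym: "near v u = near u v"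
  by (auto simp: near_def)

lemma links_sym: "links v u = links u v"
  by (simp add: links_def far_def near_sym fun_eq_iff)

lemma card_side:
  assumes "adj u v"
  shows "card (side u v) + card (nbrs u \<inter> nbrs v) + 1 = d"
proof -
  have "nbrs u = insert v (side u v \<union> (nbrs u \<inter> nbrs v))"
    using assms by (auto simp: side_def nbrs_def)
  moreover have "v \<notin> side u v \<union> (nbrs u \<inter> nbrs v)" "side u v \<inter> (nbrs u \<inter> nbrs v) = {}"
    using adj_irrefl by (auto simp: side_def nbrs_def)
  moreover have "finite (side u v)" using finite_nbrs by (simp add: side_def)
  ultimately have "card (nbrs u) = card (side u v) + card (nbrs u \<inter> nbrs v) + 1"
    using finite_nbrs by (metis (no_types, lifting) Suc_eq_plus1 card_Un_disjoint card_insert_disjoint finite_Int finite_UnI)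
  then show ?thesis using card_nbrs[OF adj_verts[OF assms]] by simp
qed

lemma card_near:
  assumes "adj u v"
  shows "card (near u v) + card (nbrs u \<inter> nbrs v) = 2 * d"
  using card_Un_Int[OF finite_nbrs finite_nbrs, of u v] card_nbrs adj_verts[OF assms]
    adj_verts[OF adj_sym[OF assms]] by (simp add: near_def)

text \<open>
  Summing degrees over \<open>near u v\<close> counts the edges inside it twice and the other edges meeting it
  once.
\<close>

lemma card_edges_near:
  assumes "adj u v"
  shows "card {e \<in> edges G. e \<inter> near u v \<noteq> {}} + card {e \<in> edges G. e \<subseteq> near u v} +
     d * card (nbrs u \<inter> nbrs v) = 2 * d * d"
proof -
  let ?W = "near u v" and ?C = "{e \<in> edges G. e \<inter> near u v \<noteq> {}}"
  have fW: "finite ?W" using finite_nbrs by (simp add: near_def)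
  have "(\<Sum>w\<in>?W. card {e \<in> edges G. w \<in> e}) = (\<Sum>w\<in>?W. d)"
    by (rule sum.cong) (auto simp: near_def nbrs_def intro: card_edges_at dest: adj_sym)
  then have "d * card ?W = (\<Sum>w\<in>?W. card {e \<in> edges G. w \<in> e})" by simp
  also have "\<dots> = (\<Sum>w\<in>?W. \<Sum>e\<in>?C. if w \<in> e then 1 else 0)"
    by (rule sum.cong) (auto simp: sum.If_cases finite_edges intro!: arg_cong[where f = card])
  also have "\<dots> = (\<Sum>e\<in>?C. card (e \<inter> ?W))"
    by (subst sum.swap) (auto simp: sum.If_cases fW Int_commute intro!: sum.cong)
  also have "\<dots> = (\<Sum>e\<in>?C. 1 + (if e \<subseteq> ?W then 1 else 0))"
  proof (rule sum.cong)
    fix e assume e: "e \<in> ?C"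
    then have "e \<in> edges G" by simp
    then obtain x y where xy: "e = {x, y}" "x \<noteq> y" by (rule edge_cases)
    then show "card (e \<inter> ?W) = 1 + (if e \<subseteq> ?W then 1 else 0)" using e by (auto simp: Int_insert_left)
  qed simp
  also have "\<dots> = card ?C + card {e \<in> ?C. e \<subseteq> ?W}"
    by (subst sum.distrib) (simp add: sum.If_cases finite_edges Collect_conj_eq Int_assoc)
  also have "{e \<in> ?C. e \<subseteq> ?W} = {e \<in> edges G. e \<subseteq> ?W}"
  proof -
    have "e \<inter> ?W \<noteq> {}" if "e \<in> edges G" "e \<subseteq> ?W" for e
      using edge_cases[OF that(1)] that(2) by (metis Int_absorb2 insert_not_empty)
    then show ?thesis by blast
  qed
  finally have "card ?C + card {e \<in> edges G. e \<subseteq> ?W} = d * card ?W" ..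
  then have "card ?C + card {e \<in> edges G. e \<subseteq> ?W} + d * card (nbrs u \<inter> nbrs v) =
      d * (card ?W + card (nbrs u \<inter> nbrs v))"
    by (simp add: algebra_simps)
  then show ?thesis by (simp add: card_near[OF assms])
qed

text \<open>
  The private edges inside \<open>near u v\<close> are compared with all edges inside it: those from \<open>u\<close> or \<open>v\<close> to
  side vertices outside \<open>F\<close> are not private. The other private edges go from \<open>near u v\<close> to far
  vertices. A common neighbour of \<open>u\<close> and \<open>v\<close> starts at most \<open>d - 2\<close> of these, which accounts for the
  terms with \<open>nbrs u \<inter> nbrs v\<close>.
\<close>

lemma card_private_edges:
  assumes c: "covered u v F"
  shows "card {e \<in> edges G. e \<subseteq> F} + card (side u v - F) + card (side v u - F) + 2 * card (nbrs u \<inter> nbrs v) \<le>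
     card {e \<in> edges G. e \<subseteq> near u v} + d * card (nbrs u \<inter> nbrs v) +
     (\<Sum>x\<in>side u v \<inter> F. links u v F x) + (\<Sum>x\<in>side v u \<inter> F. links u v F x)"
proof -
  have uv: "adj u v" "adj v u" "u \<noteq> v" "u \<in> F" "v \<in> F" using c adj_sym adj_irrefl by (auto simp: covered_def)
  let ?W = "near u v" and ?K = "nbrs u \<inter> nbrs v" and ?P = "{e \<in> edges G. e \<subseteq> F}"
  let ?A = "side u v" and ?B = "side v u"
  have fin: "finite ?A" "finite ?B" "finite ?K" using finite_nbrs by (simp_all add: side_def)
  \<comment> \<open>\<open>E1\<close>: private edges near \<open>{u, v}\<close>; \<open>E2\<close> and \<open>E3\<close>: edges there that are not private\<close>
  define E1 where "E1 = {e \<in> ?P. e \<subseteq> ?W}"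
  define E2 where "E2 = (\<lambda>a. {u, a}) ` (?A - F)"
  define E3 where "E3 = (\<lambda>b. {v, b}) ` (?B - F)"
  have "card E2 = card (?A - F)" "card E3 = card (?B - F)"
    unfolding E2_def E3_def by (rule card_image; auto simp: inj_on_def doubleton_eq_iff)+
  moreover have "card (E1 \<union> E2 \<union> E3) = card E1 + card E2 + card E3"
  proof -
    have "E1 \<inter> E2 = {}" "(E1 \<union> E2) \<inter> E3 = {}"
      using uv by (auto simp: E1_def E2_def E3_def side_def doubleton_eq_iff)
    moreover have "finite E1" "finite E2" "finite E3"
      using finite_edges fin by (auto simp: E1_def E2_def E3_def)
    ultimately show ?thesis by (simp add: card_Un_disjoint)
  qed
  moreover have "card (E1 \<union> E2 \<union> E3) \<le> card {e \<in> edges G. e \<subseteq> ?W}"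
  proof (rule card_mono)
    show "E1 \<union> E2 \<union> E3 \<subseteq> {e \<in> edges G. e \<subseteq> ?W}"
      using uv by (auto simp: E1_def E2_def E3_def side_def near_def nbrs_def adj_def insert_commute)
  qed (simp add: finite_edges)
  ultimately have inner: "card E1 + card (?A - F) + card (?B - F) \<le> card {e \<in> edges G. e \<subseteq> ?W}" by simp
  have out: "?P - E1 \<subseteq> (\<Union>x\<in>(?A \<union> ?B \<union> ?K) \<inter> F. (\<lambda>y. {x, y}) ` (nbrs x \<inter> (F - ?W)))" (is "_ \<subseteq> ?R")
  proof
    fix e assume e: "e \<in> ?P - E1"
    then have "e \<in> edges G" by simp
    then obtain p q where pq: "e = {p, q}" "adj p q" by (rule edge_cases)
    have "p \<in> ?W \<or> q \<in> ?W" "p \<notin> ?W \<or> q \<notin> ?W"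
      using e pq c by (auto simp: E1_def covered_def)
    then consider "p \<in> ?W" "q \<notin> ?W" | "q \<in> ?W" "p \<notin> ?W" by blast
    then have "\<exists>x y. e = {x, y} \<and> adj x y \<and> x \<in> ?W \<and> y \<notin> ?W"
    proof cases
      case 2
      then show ?thesis using pq adj_sym by (metis insert_commute)
    qed (use pq in blast)
    then obtain x y where xy: "e = {x, y}" "adj x y" "x \<in> ?W" "y \<notin> ?W" by blast
    have "x \<noteq> u" "x \<noteq> v" using xy by (auto simp: near_def nbrs_def)
    then have "x \<in> ?A \<union> ?B \<union> ?K" using xy(3) by (auto simp: near_def side_def)
    moreover have "x \<in> F" "y \<in> F" using e xy by auto
    ultimately show "e \<in> ?R" using xy by (auto simp: nbrs_def)
  qed
  have "card (?P - E1) \<le> card ?R"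
    by (rule card_mono[OF _ out]) (use fin finite_nbrs in auto)
  also have "\<dots> \<le> (\<Sum>x\<in>(?A \<union> ?B \<union> ?K) \<inter> F. card ((\<lambda>y. {x, y}) ` (nbrs x \<inter> (F - ?W))))"
    by (rule card_UN_le) (use fin in auto)
  also have "\<dots> \<le> (\<Sum>x\<in>(?A \<union> ?B \<union> ?K) \<inter> F. links u v F x)"
    unfolding links_def far_def by (intro sum_mono card_image_le) (simp add: finite_nbrs)
  also have "\<dots> = (\<Sum>x\<in>?A \<inter> F. links u v F x) + (\<Sum>x\<in>?B \<inter> F. links u v F x) + (\<Sum>x\<in>?K \<inter> F. links u v F x)"
  proof -
    have "(?A \<union> ?B \<union> ?K) \<inter> F = ((?A \<inter> F) \<union> (?B \<inter> F)) \<union> (?K \<inter> F)" by auto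
    moreover have "(?A \<inter> F) \<inter> (?B \<inter> F) = {}" "((?A \<inter> F) \<union> (?B \<inter> F)) \<inter> (?K \<inter> F) = {}"
      by (auto simp: side_def)
    ultimately show ?thesis using fin by (simp add: sum.union_disjoint)
  qed
  also have "(\<Sum>x\<in>?K \<inter> F. links u v F x) \<le> (\<Sum>x\<in>?K \<inter> F. d - 2)"
  proof (rule sum_mono)
    fix x assume x: "x \<in> ?K \<inter> F"
    have "{u, v} \<union> (nbrs x \<inter> (F - ?W)) \<subseteq> nbrs x"
      using x adj_sym by (auto simp: nbrs_def)
    then have "card ({u, v} \<union> (nbrs x \<inter> (F - ?W))) \<le> card (nbrs x)"
      by (intro card_mono finite_nbrs)
    moreover have "card ({u, v} \<union> (nbrs x \<inter> (F - ?W))) = 2 + links u v F x"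
      unfolding links_def far_def using uv finite_nbrs
      by (subst card_Un_disjoint) (auto simp: near_def nbrs_def)
    moreover have "card (nbrs x) = d" using x by (intro card_nbrs) (auto simp: nbrs_def dest: adj_sym adj_verts)
    ultimately show "links u v F x \<le> d - 2" by simp
  qed
  also have "(\<Sum>x\<in>?K \<inter> F. d - 2) \<le> card ?K * (d - 2)"
    using card_mono[OF fin(3) Int_lower1[of ?K F]] by simp
  finally have outer: "card (?P - E1) \<le> (\<Sum>x\<in>?A \<inter> F. links u v F x) + (\<Sum>x\<in>?B \<inter> F. links u v F x) + card ?K * (d - 2)"
    by simp
  have "card ?P = card E1 + card (?P - E1)"
  proof -
    have "E1 \<subseteq> ?P" "finite ?P" using finite_edges by (auto simp: E1_def)
    then show ?thesis by (metis card_Diff_subset card_mono finite_subset le_add_diff_inverse)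
  qed
  moreover have "card ?K * (d - 2) + 2 * card ?K \<le> d * card ?K"
  proof (cases "card ?K = 0")
    case False
    then have "2 \<le> d" using card_side[OF uv(1)] by linarith
    then have "d = (d - 2) + 2" by simp
    then show ?thesis by (metis add_mult_distrib mult.commute order_refl)
  qed simp
  ultimately show ?thesis using inner outer by linarith
qed

text \<open>
  The edges inside \<open>near u v\<close> cancel: they reduce the number of conflicts by as much as they can
  contribute private edges.
\<close>

lemma card_conflict_private:
  assumes c: "covered u v F"
  shows "card {e \<in> edges G. e \<inter> near u v \<noteq> {}} + card {e \<in> edges G. e \<subseteq> F} +
      card (side u v - F) + card (side v u - F) + 2 * card (nbrs u \<inter> nbrs v) \<le>
     2 * d * d + (\<Sum>x\<in>side u v \<inter> F. links u v F x) + (\<Sum>x\<in>side v u \<inter> F. links u v F x)"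
  using card_private_edges[OF c] card_edges_near[of u v] c unfolding covered_def by linarith

end

section \<open>Private edges in graphs without induced four-cycles\<close>

context graph
begin

lemma induced_C4:
  assumes free: "free_of \<F> G" "cycle 4 \<in> \<F>"
    and adj: "adj a b" "adj b c" "adj c e" "adj e a" and ne: "a \<noteq> c" "b \<noteq> e"
  shows "adj a c \<or> adj b e"
proof (rule ccontr)
  assume neg: "\<not> (adj a c \<or> adj b e)"
  have d: "a \<noteq> b" "b \<noteq> c" "c \<noteq> e" "e \<noteq> a" using adj adj_irrefl by auto
  let ?U = "{a, b, c, e}"
  let ?f = "(\<lambda>x. 0::nat)(b := 1, c := 2, e := 3)"
  have U: "?U \<subseteq> verts G" using adj adj_verts by blast
  have E: "{h \<in> edges G. h \<subseteq> ?U} = {{a, b}, {b, c}, {c, e}, {e, a}}"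
  proof (intro equalityI subsetI)
    fix h assume h: "h \<in> {h \<in> edges G. h \<subseteq> ?U}"
    then have "h \<in> edges G" by simp
    then obtain x y where xy: "h = {x, y}" "adj x y" "x \<noteq> y" by (rule edge_cases)
    have "x \<in> ?U" "y \<in> ?U" using h xy by auto
    moreover have "\<not> adj a c" "\<not> adj c a" "\<not> adj b e" "\<not> adj e b" using neg adj_sym by blast+
    ultimately show "h \<in> {{a, b}, {b, c}, {c, e}, {e, a}}"
      using xy by (auto simp: insert_commute)
  qed (use adj in \<open>auto simp: adj_def\<close>)
  have C: "edges (cycle 4) = {{0, 1}, {1, 2}, {2, 3}, {3, 0}}"
  proof -
    have "{{i, (i + 1) mod 4} | i. i < (4 :: nat)} = (\<lambda>i. {i, (i + 1) mod 4}) ` {..<4}" by auto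
    also have "{..<4 :: nat} = {0, 1, 2, 3}" by auto
    finally show ?thesis by (simp add: cycle_def del: One_nat_def)
  qed
  have "bij_betw ?f ?U {0..<4}"
    by (rule bij_betw_imageI) (use d ne in \<open>auto simp: inj_on_def\<close>)
  moreover have "(\<lambda>h. ?f ` h) ` {h \<in> edges G. h \<subseteq> ?U} = edges (cycle 4)"
    unfolding E C using d ne by (simp add: insert_commute)
  ultimately have "isomorphic (induced_subgraph G ?U) (cycle 4)"
    unfolding isomorphic_def induced_subgraph_def by (intro exI[of _ ?f]) (simp add: cycle_def)
  then show False using free U by (auto simp: free_of_def)
qed

lemma induced_C3:
  assumes free: "free_of \<F> G" "cycle 3 \<in> \<F>"
    and adj: "adj a b" "adj b c" "adj c a"
  shows False
proof -
  have d: "a \<noteq> b" "b \<noteq> c" "c \<noteq> a" using adj adj_irrefl by auto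
  let ?U = "{a, b, c}"
  let ?f = "(\<lambda>x. 0::nat)(b := 1, c := 2)"
  have U: "?U \<subseteq> verts G" using adj adj_verts by blast
  have E: "{h \<in> edges G. h \<subseteq> ?U} = {{a, b}, {b, c}, {c, a}}"
  proof (intro equalityI subsetI)
    fix h assume h: "h \<in> {h \<in> edges G. h \<subseteq> ?U}"
    then have "h \<in> edges G" by simp
    then obtain x y where xy: "h = {x, y}" "x \<noteq> y" by (rule edge_cases)
    have "x \<in> ?U" "y \<in> ?U" using h xy by auto
    then show "h \<in> {{a, b}, {b, c}, {c, a}}" using xy by (auto simp: insert_commute)
  qed (use adj in \<open>auto simp: adj_def\<close>)
  have C: "edges (cycle 3) = {{0, 1}, {1, 2}, {2, 0}}"
  proof -
    have "{{i, (i + 1) mod 3} | i. i < (3 :: nat)} = (\<lambda>i. {i, (i + 1) mod 3}) ` {..<3}" by auto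
    also have "{..<3 :: nat} = {0, 1, 2}" by auto
    finally show ?thesis by (simp add: cycle_def del: One_nat_def)
  qed
  have "bij_betw ?f ?U {0..<3}"
    by (rule bij_betw_imageI) (use d in \<open>auto simp: inj_on_def\<close>)
  moreover have "(\<lambda>h. ?f ` h) ` {h \<in> edges G. h \<subseteq> ?U} = edges (cycle 3)"
    unfolding E C using d by (simp add: insert_commute)
  ultimately have "isomorphic (induced_subgraph G ?U) (cycle 3)"
    unfolding isomorphic_def induced_subgraph_def by (intro exI[of _ ?f]) (simp add: cycle_def)
  then show False using free U by (auto simp: free_of_def)
qed

end

locale c4_free_regular = regular_graph +
  assumes C4: "adj a b \<Longrightarrow> adj b c \<Longrightarrow> adj c e \<Longrightarrow> adj e a \<Longrightarrow> a \<noteq> c \<Longrightarrow> b \<noteq> e \<Longrightarrow> adj a c \<or> adj b e"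
begin

text \<open>
  Both conditions of local optimality, the second one saying that private edges pairwise conflict.
  The notion is symmetric in \<open>u\<close> and \<open>v\<close>, so each statement about \<open>side u v\<close> also holds for \<open>side v u\<close>.
\<close>

definition exclusive :: "'a \<Rightarrow> 'a \<Rightarrow> 'a set \<Rightarrow> bool" where
  "exclusive u v F \<longleftrightarrow> covered u v F \<and>
     (\<forall>x\<in>F. \<forall>y\<in>F. \<forall>z\<in>F. \<forall>w\<in>F. adj x y \<longrightarrow> adj z w \<longrightarrow>
        x = z \<or> x = w \<or> y = z \<or> y = w \<or> adj x z \<or> adj x w \<or> adj y z \<or> adj y w)"

lemma exclusive_covered: "exclusive u v F \<Longrightarrow> covered u v F"
  by (simp add: exclusive_def)

lemma covered_sym: "covered u v F \<Longrightarrow> covered v u F"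
  by (auto simp: covered_def near_sym adj_sym)

lemma exclusive_sym: "exclusive u v F \<Longrightarrow> exclusive v u F"
  by (auto simp: exclusive_def covered_sym)

definition linked :: "'a \<Rightarrow> 'a \<Rightarrow> 'a set \<Rightarrow> 'a set" where
  "linked u v F = {x \<in> side u v \<inter> F. nbrs x \<inter> far u v F \<noteq> {}}"

lemma far_sym: "far u v F = far v u F"
  by (simp add: far_def near_sym)

lemma exclusive_conflict:
  assumes "exclusive u v F" "x \<in> F" "y \<in> F" "z \<in> F" "w \<in> F" "adj x y" "adj z w"
  shows "x = z \<or> x = w \<or> y = z \<or> y = w \<or> adj x z \<or> adj x w \<or> adj y z \<or> adj y w"
  using assms unfolding exclusive_def by blast

lemma exclusiveD:
  assumes "exclusive u v F"
  shows "adj u v" "adj v u" "u \<in> F" "v \<in> F"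
  using assms adj_sym by (auto simp: exclusive_def covered_def)

lemma far_independent: "exclusive u v F \<Longrightarrow> y \<in> far u v F \<Longrightarrow> y' \<in> far u v F \<Longrightarrow> \<not> adj y y'"
  unfolding exclusive_def covered_def far_def by blast

lemma sideD: "x \<in> side u v \<Longrightarrow> adj u x \<and> adj x u \<and> \<not> adj v x \<and> \<not> adj x v \<and> x \<noteq> v \<and> x \<noteq> u"
  using adj_sym adj_irrefl by (auto simp: side_def nbrs_def)

lemma farD: "y \<in> far u v F \<Longrightarrow> y \<in> F \<and> \<not> adj u y \<and> \<not> adj y u \<and> \<not> adj v y \<and> \<not> adj y v"
  using adj_sym by (auto simp: far_def near_def nbrs_def)

lemma side_near: "x \<in> side u v \<Longrightarrow> x \<in> near u v"
  by (auto simp: side_def near_def)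

text \<open>
  An edge \<open>{x, z}\<close> between the sides would close the induced cycle \<open>u x z v\<close>.
\<close>

lemma sides_not_adj:
  assumes uv: "adj u v" and x: "x \<in> side u v" and z: "z \<in> side v u"
  shows "\<not> adj x z" "x \<noteq> z"
proof -
  show "x \<noteq> z" using sideD[OF x] sideD[OF z] by blast
  show "\<not> adj x z"
  proof
    assume "adj x z"
    then show False
      using C4[of u x z v] sideD[OF x] sideD[OF z] uv adj_sym by blast
  qed
qed

text \<open>
  Let \<open>x\<close> and \<open>x'\<close> be non-adjacent with far neighbours \<open>y\<close> and \<open>y'\<close>. A common far neighbour \<open>z\<close> would give
  the induced cycle \<open>u x z x'\<close>, and \<open>y\<close> and \<open>y'\<close> are not adjacent, so the private edges \<open>{x, y}\<close> and
  \<open>{x', y'}\<close> would not conflict.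
\<close>

lemma linked_clique:
  assumes e: "exclusive u v F" and x: "x \<in> linked u v F" and x': "x' \<in> linked u v F" and ne: "x \<noteq> x'"
  shows "adj x x'"
proof (rule ccontr)
  assume n: "\<not> adj x x'"
  obtain y where y: "y \<in> far u v F" "adj x y" using x by (auto simp: linked_def nbrs_def)
  obtain y' where y': "y' \<in> far u v F" "adj x' y'" using x' by (auto simp: linked_def nbrs_def)
  have s: "x \<in> side u v" "x \<in> F" "x' \<in> side u v" "x' \<in> F" using x x' by (auto simp: linked_def)
  have no_common: "\<not> (adj x z \<and> adj x' z)" if "z \<in> far u v F" for z
  proof
    assume z: "adj x z \<and> adj x' z"
    have "u \<noteq> z" using farD[OF that] exclusiveD(1)[OF e] adj_sym by blast
    then show False
      using C4[of u x z x'] z sideD[OF s(1)] sideD[OF s(3)] farD[OF that] ne n adj_sym by blast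
  qed
  have "x \<noteq> y'" "y \<noteq> x'" using s y y' side_near by (auto simp: far_def)
  moreover have "\<not> adj y y'" using far_independent[OF e y(1) y'(1)] .
  moreover have "y \<noteq> y'" "\<not> adj x y'" "\<not> adj y x'" using no_common y y' adj_sym by blast+
  ultimately show False
    using exclusive_conflict[OF e s(2) _ s(4) _ y(2) y'(2)] farD[OF y(1)] farD[OF y'(1)] ne n by blast
qed

text \<open>
  The private edges \<open>{x, y}\<close> and \<open>{v, b}\<close> conflict, and \<open>{b, y}\<close> is the only edge left that can join
  them.
\<close>

lemma far_link_dominates:
  assumes e: "exclusive u v F" and x: "x \<in> side u v \<inter> F" and y: "y \<in> far u v F" "adj x y"
    and b: "b \<in> side v u \<inter> F"
  shows "adj b y"
proof -
  have uv: "adj u v" "v \<in> F" using exclusiveD[OF e] by blast+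
  have vb: "adj v b" using b sideD by blast
  have nb: "\<not> adj x b" "x \<noteq> b" using sides_not_adj[OF uv(1)] x b by blast+
  have "y \<noteq> v" "y \<noteq> b" using y(1) uv(1) b by (auto simp: far_def near_def side_def nbrs_def)
  moreover have "x \<noteq> v" "\<not> adj x v" using sideD x by blast+
  moreover have "\<not> adj y v" using farD[OF y(1)] by blast
  ultimately show ?thesis
    using exclusive_conflict[OF e _ _ uv(2) _ y(2) vb] x b farD[OF y(1)] nb adj_sym by blast
qed

lemma finite_side: "finite (side u v)"
  using finite_nbrs by (simp add: side_def)

lemma sum_links: "(\<Sum>x\<in>side u v \<inter> F. links u v F x) = (\<Sum>x\<in>linked u v F. links u v F x)"
  by (rule sum.mono_neutral_right) (auto simp: finite_side linked_def links_def)

text \<open>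
  The neighbours of \<open>x\<close> include \<open>u\<close>, the rest of the clique of linked vertices, and the far vertices
  counted by \<open>links\<close>.
\<close>

lemma links_le:
  assumes e: "exclusive u v F" and x: "x \<in> linked u v F"
  shows "links u v F x + card (linked u v F) \<le> d"
proof -
  let ?T = "linked u v F"
  have T: "?T \<subseteq> side u v" by (auto simp: linked_def)
  then have fT: "finite ?T" using finite_side finite_subset by blast
  have xs: "x \<in> side u v" using x T by blast
  have "insert u ((?T - {x}) \<union> (nbrs x \<inter> far u v F)) \<subseteq> nbrs x"
    using linked_clique[OF e x] sideD[OF xs] by (auto simp: nbrs_def)
  then have "card (insert u ((?T - {x}) \<union> (nbrs x \<inter> far u v F))) \<le> card (nbrs x)"
    by (intro card_mono finite_nbrs)
  moreover have "u \<notin> (?T - {x}) \<union> (nbrs x \<inter> far u v F)"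
    using T sideD exclusiveD(2)[OF e] farD by blast
  moreover have "card ((?T - {x}) \<union> (nbrs x \<inter> far u v F)) = card (?T - {x}) + links u v F x"
    unfolding links_def using fT finite_nbrs T side_near
    by (intro card_Un_disjoint) (auto simp: far_def)
  moreover have "card (nbrs x) = d" using sideD[OF xs] adj_verts by (intro card_nbrs) blast
  moreover have "Suc (card (?T - {x})) = card ?T" using fT x by (rule card_Suc_Diff1)
  ultimately show ?thesis using fT finite_nbrs by simp
qed

lemma sum_links_le:
  assumes e: "exclusive u v F"
  shows "(\<Sum>x\<in>side u v \<inter> F. links u v F x) \<le> card (linked u v F) * (d - card (linked u v F))"
proof -
  have "links u v F x \<le> d - card (linked u v F)" if "x \<in> linked u v F" for x
    using links_le[OF e that] by simp
  then show ?thesis unfolding sum_links by (rule sum_bounded_above[THEN order_trans]) simp_all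
qed

text \<open>
  A vertex of \<open>F\<close> on the other side would be adjacent to the far neighbours of the first side.
\<close>

lemma one_sided:
  assumes e: "exclusive u v F" and l: "linked u v F \<noteq> {}" and r: "linked v u F = {}"
  shows "side v u \<inter> F = {}"
proof -
  obtain x y where x: "x \<in> side u v \<inter> F" and y: "y \<in> far u v F" "adj x y"
    using l by (auto simp: linked_def nbrs_def)
  show ?thesis
  proof (rule ccontr)
    assume "side v u \<inter> F \<noteq> {}"
    then obtain b where b: "b \<in> side v u \<inter> F" by blast
    have "adj b y" by (rule far_link_dominates[OF e x y b])
    then have "b \<in> linked v u F" using b y by (auto simp: linked_def nbrs_def far_sym)
    then show False using r by simp
  qed
qed

text \<open>
  All vertices of \<open>F\<close> on both sides are adjacent to the same far vertices. There is only one such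
  vertex, since two would close an induced four-cycle with one vertex of each side.
\<close>

lemma two_sided:
  assumes e: "exclusive u v F" and l: "linked u v F \<noteq> {}" and r: "linked v u F \<noteq> {}"
  shows "linked u v F = side u v \<inter> F" "x \<in> linked u v F \<Longrightarrow> links u v F x = 1"
    "card (linked u v F) + card (linked v u F) \<le> d"
proof -
  have e': "exclusive v u F" using exclusive_sym[OF e] .
  obtain x y where x: "x \<in> side u v \<inter> F" and y: "y \<in> far u v F" "adj x y"
    using l by (auto simp: linked_def nbrs_def)
  obtain z w where z: "z \<in> side v u \<inter> F" and w: "w \<in> far u v F" "adj z w"
    using r by (auto simp: linked_def nbrs_def far_sym)
  note dom = far_link_dominates[OF e] and dom' = far_link_dominates[OF e', unfolded far_sym[of v u]]
  have zall: "adj z y'" if "x' \<in> side u v \<inter> F" "y' \<in> far u v F" "adj x' y'" for x' y'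
    using dom[OF that z] .
  have all: "adj x' y'" if x': "x' \<in> side u v \<inter> F" and y': "y' \<in> far u v F" and "adj z y'" for x' y'
    using dom'[OF z y' that(3) x'] .
  show T: "linked u v F = side u v \<inter> F"
  proof
    show "side u v \<inter> F \<subseteq> linked u v F"
      using all[OF _ w] w by (auto simp: linked_def nbrs_def)
  qed (auto simp: linked_def)
  have uv: "adj u v" using exclusiveD[OF e] by blast
  have uniq: "y1 = y2" if "x' \<in> side u v \<inter> F" "y1 \<in> far u v F" "adj x' y1" "y2 \<in> far u v F" "adj x' y2" for x' y1 y2
  proof (rule ccontr)
    assume "y1 \<noteq> y2"
    moreover have "adj z y1" "adj z y2" using zall that by blast+
    moreover have "\<not> adj x' z" "x' \<noteq> z" using sides_not_adj[OF uv] that(1) z by blast+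
    moreover have "\<not> adj y1 y2" using far_independent[OF e] that by blast
    \<comment> \<open>the cycle \<open>x' y1 z y2\<close> has no chord\<close>
    ultimately show False using C4[of x' y1 z y2] that adj_sym by blast
  qed
  show "links u v F x = 1" if xl: "x \<in> linked u v F" for x
  proof -
    obtain y1 where y1: "y1 \<in> nbrs x \<inter> far u v F" using xl by (auto simp: linked_def)
    then have "nbrs x \<inter> far u v F = {y1}" using uniq[of x] xl by (auto simp: linked_def nbrs_def)
    then show ?thesis by (simp add: links_def)
  qed
  have "linked u v F \<union> linked v u F \<subseteq> nbrs y"
    using all[OF _ y(1) zall[OF x y]] dom[OF x y] adj_sym by (auto simp: linked_def nbrs_def)
  then have "card (linked u v F \<union> linked v u F) \<le> d"
    using card_mono[OF finite_nbrs] card_nbrs[of y] y adj_verts adj_sym by metis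
  moreover have "linked u v F \<inter> linked v u F = {}"
    by (auto simp: linked_def side_def)
  moreover have "finite (linked u v F)" "finite (linked v u F)"
    using finite_side by (auto simp: linked_def)
  ultimately show "card (linked u v F) + card (linked v u F) \<le> d"
    by (simp add: card_Un_disjoint)
qed

text \<open>
  The edges in conflict with \<open>{u, v}\<close>, and the edges private to it.
\<close>

abbreviation "conflicts u v \<equiv> {e \<in> edges G. e \<inter> near u v \<noteq> {}}"
abbreviation "privates F \<equiv> {e \<in> edges G. e \<subseteq> F}"

lemma card_conflicts_privates_unlinked:
  assumes e: "exclusive u v F" and l: "linked u v F = {}" and r: "linked v u F = {}"
  shows "card (conflicts u v) + card (privates F) \<le> 2 * d * d"
proof -
  have "(\<Sum>x\<in>side u v \<inter> F. links u v F x) = 0" "(\<Sum>x\<in>side v u \<inter> F. links v u F x) = 0"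
    unfolding sum_links l r by simp_all
  then show ?thesis
    using card_conflict_private[OF exclusive_covered[OF e]] unfolding links_sym[of u v] by linarith
qed

lemma card_conflicts_privates_one_sided:
  assumes e: "exclusive u v F" and l: "linked u v F \<noteq> {}" and r: "linked v u F = {}"
  shows "card (conflicts u v) + card (privates F) + (d - 1) \<le>
     2 * d * d + card (linked u v F) * (d - card (linked u v F))"
proof -
  have "(\<Sum>x\<in>side v u \<inter> F. links v u F x) = 0"
    unfolding sum_links r by simp
  moreover have "side v u - F = side v u" using one_sided[OF e l r] by blast
  then have "card (side v u - F) = card (side v u)" by simp
  moreover have "card (side v u) + card (nbrs u \<inter> nbrs v) + 1 = d"
    using card_side[OF exclusiveD(2)[OF e]] by (simp add: Int_commute)
  ultimately show ?thesis
    using card_conflict_private[OF exclusive_covered[OF e]] sum_links_le[OF e] unfolding links_sym[of u v]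
    by linarith
qed

lemma card_conflicts_privates_two_sided:
  assumes e: "exclusive u v F" and l: "linked u v F \<noteq> {}" and r: "linked v u F \<noteq> {}"
  shows "card (conflicts u v) + card (privates F) + 2 * (d - 1) \<le>
     2 * d * d + 2 * (card (linked u v F) + card (linked v u F))"
proof -
  have e': "exclusive v u F" using exclusive_sym[OF e] .
  have "(\<Sum>x\<in>side u v \<inter> F. links u v F x) = card (linked u v F)"
    unfolding sum_links using two_sided(2)[OF e l r] by simp
  moreover have "(\<Sum>x\<in>side v u \<inter> F. links v u F x) = card (linked v u F)"
    unfolding sum_links using two_sided(2)[OF e' r l] by simp
  moreover have "card (side u v - F) + card (linked u v F) = card (side u v)"
    unfolding two_sided(1)[OF e l r] using finite_side by (metis add.commute card_Int_Diff)
  moreover have "card (side v u - F) + card (linked v u F) = card (side v u)"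
    unfolding two_sided(1)[OF e' r l] using finite_side by (metis add.commute card_Int_Diff)
  moreover have "card (side v u) + card (nbrs u \<inter> nbrs v) + 1 = d" "card (side u v) + card (nbrs u \<inter> nbrs v) + 1 = d"
    using card_side[OF exclusiveD(2)[OF e]] card_side[OF exclusiveD(1)[OF e]] by (simp_all add: Int_commute)
  ultimately have "card (side u v - F) + card (side v u - F) + 2 * card (nbrs u \<inter> nbrs v) +
      (card (linked u v F) + card (linked v u F)) = 2 * (d - 1)" and
    "(\<Sum>x\<in>side u v \<inter> F. links u v F x) + (\<Sum>x\<in>side v u \<inter> F. links v u F x) =
      card (linked u v F) + card (linked v u F)"
    by simp_all
  then show ?thesis
    using card_conflict_private[OF exclusive_covered[OF e]] unfolding links_sym[of u v]
    by simp
qed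

text \<open>
  The cases give at most \<open>2d\<^sup>2\<close>, at most \<open>2d\<^sup>2 - (d - 1) + d\<^sup>2/4\<close> and at most \<open>2d\<^sup>2 + 2\<close>; each of
  these is below the stated bound because \<open>d \<ge> 3\<close>.
\<close>

lemma card_conflicts_privates_C4_free:
  assumes e: "exclusive u v F" and d: "3 \<le> d"
  shows "real (card (conflicts u v) + card (privates F)) \<le> 9 / 4 * real d ^ 2 + 21 / 40 * real d - 33 / 40"
proof -
  let ?n = "card (conflicts u v) + card (privates F)"
  have d3: "3 * real d \<le> real d ^ 2" using d by (simp add: power2_eq_square)
  have one: "real ?n \<le> 9 / 4 * real d ^ 2 + 21 / 40 * real d - 33 / 40"
    if b: "?n + (d - 1) \<le> 2 * d * d + t * (d - t)" for t
  proof (cases "t \<le> d")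
    case True
    have le: "real (?n + (d - 1)) \<le> real (2 * d * d + t * (d - t))" using b by (rule of_nat_mono)
    have "real ?n + (real d - 1) \<le> 2 * real d ^ 2 + real t * (real d - real t)"
    proof -
      have "real (t * (d - t)) = real t * (real d - real t)" using True by simp
      moreover have "real (d - 1) = real d - 1" using d by simp
      moreover have "real (2 * d * d) = 2 * real d ^ 2" by (simp add: power2_eq_square)
      ultimately show ?thesis using le unfolding of_nat_add by linarith
    qed
    moreover have "real t * (real d - real t) \<le> real d ^ 2 / 4"
      using zero_le_power2[of "real t - real d / 2"] by (simp add: power2_eq_square algebra_simps)
    ultimately show ?thesis using d3 d by linarith
  next
    case False
    then have "?n \<le> 2 * d * d" using b by simp
    then have "real ?n \<le> real (2 * d * d)" by (rule of_nat_mono)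
    then show ?thesis using d3 d by (simp add: power2_eq_square)
  qed
  consider "linked u v F = {}" "linked v u F = {}" | "linked u v F \<noteq> {}" "linked v u F = {}"
    | "linked u v F = {}" "linked v u F \<noteq> {}" | "linked u v F \<noteq> {}" "linked v u F \<noteq> {}" by blast
  then show ?thesis
  proof cases
    case 1
    from card_conflicts_privates_unlinked[OF e 1] have "real ?n \<le> real (2 * d * d)" by (rule of_nat_mono)
    then show ?thesis using d3 d by (simp add: power2_eq_square)
  next
    case 2
    from one[OF card_conflicts_privates_one_sided[OF e 2]] show ?thesis .
  next
    case 3
    from card_conflicts_privates_one_sided[OF exclusive_sym[OF e] 3(2,1)] show ?thesis
      by (intro one) (simp add: near_sym)
  next
    case 4
    have "?n + 2 * (d - 1) \<le> 2 * d * d + 2 * d"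
      by (rule order_trans[OF card_conflicts_privates_two_sided[OF e 4]]) (use two_sided(3)[OF e 4] in simp)
    moreover have "d = (d - 1) + 1" using d by simp
    ultimately have "?n \<le> 2 * d * d + 2" by linarith
    then have "real ?n \<le> real (2 * d * d + 2)" by (rule of_nat_mono)
    moreover have "real (2 * d * d + 2) = 2 * real d ^ 2 + 2" by (simp add: power2_eq_square)
    moreover have "3 \<le> real d" using d by simp
    ultimately show ?thesis using d3 by linarith
  qed
qed

text \<open>
  Two adjacent vertices on a side would form a triangle with its end of \<open>{u, v}\<close>, so each side has at
  most one linked vertex, with at most \<open>d - 1\<close> far neighbours. If both sides are linked, the bound is
  \<open>2d\<^sup>2 - 2(d - 1) + 4\<close>, which is at most \<open>2d\<^sup>2\<close> because \<open>d \<ge> 3\<close>.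
\<close>

lemma card_conflicts_privates_C3_C4_free:
  assumes e: "exclusive u v F" and d: "3 \<le> d"
    and C3: "\<And>a b c. adj a b \<Longrightarrow> adj b c \<Longrightarrow> adj c a \<Longrightarrow> False"
  shows "card (conflicts u v) + card (privates F) \<le> 2 * d * d"
proof -
  have one: "card (linked u v F) \<le> 1" if "exclusive u v F" for u v
  proof -
    have "x = x'" if "x \<in> linked u v F" "x' \<in> linked u v F" for x x'
      using linked_clique[OF \<open>exclusive u v F\<close> that] C3[of u x x'] that sideD
      unfolding linked_def by blast
    moreover have "finite (linked u v F)" using finite_side by (simp add: linked_def)
    ultimately show ?thesis by (simp add: card_le_Suc0_iff_eq)
  qed
  have prod: "card (linked u v F) * (d - card (linked u v F)) \<le> d - 1" if "exclusive u v F" for u v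
    using one[OF that] by (cases "card (linked u v F)") auto
  consider "linked u v F = {}" "linked v u F = {}" | "linked u v F \<noteq> {}" "linked v u F = {}"
    | "linked u v F = {}" "linked v u F \<noteq> {}" | "linked u v F \<noteq> {}" "linked v u F \<noteq> {}" by blast
  then show ?thesis
  proof cases
    case 1
    from card_conflicts_privates_unlinked[OF e 1] show ?thesis .
  next
    case 2
    from card_conflicts_privates_one_sided[OF e 2] prod[OF e] show ?thesis by linarith
  next
    case 3
    from card_conflicts_privates_one_sided[OF exclusive_sym[OF e] 3(2,1)] prod[OF exclusive_sym[OF e]] show ?thesis
      unfolding near_sym[of u v] by linarith
  next
    case 4
    have "card (linked u v F) + card (linked v u F) \<le> d - 1"
      using one[OF e] one[OF exclusive_sym[OF e]] d by linarith
    then show ?thesis using card_conflicts_privates_two_sided[OF e 4] by simp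
  qed
qed

end

section \<open>The approximation factors\<close>

context c4_free_regular
begin

lemma conflict_near_iff:
  assumes "adj u v" "f \<in> edges G"
  shows "conflict {u, v} f \<longleftrightarrow> f \<inter> near u v \<noteq> {}"
proof -
  obtain x y where f: "f = {x, y}" "adj x y" using assms(2) by (rule edge_cases)
  have "x \<in> near u v \<or> y \<in> near u v" if "{u, v} \<inter> {x, y} \<noteq> {}"
    using that f(2) assms(1) adj_sym by (auto simp: near_def nbrs_def)
  then show ?thesis unfolding f(1) conflict_iff by (auto simp: near_def nbrs_def)
qed

text \<open>
  The link between Local Search and the counting: every edge of the matching satisfies \<open>exclusive\<close>.
\<close>

lemma exists_exclusive:
  assumes M: "locally_optimal M" and e: "e \<in> M"
  shows "\<exists>u v F. e = {u, v} \<and> exclusive u v F \<and> private_to M e = privates F \<and>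
    {f \<in> edges G. conflict e f} = conflicts u v"
proof -
  have sub: "M \<subseteq> edges G" and ind: "\<And>e e'. e \<in> M \<Longrightarrow> e' \<in> M \<Longrightarrow> conflict e e' \<Longrightarrow> e = e'"
    using M by (simp_all add: locally_optimal_def induced_matching_conflict)
  have "e \<in> edges G" using e sub by blast
  then obtain u v where uv: "e = {u, v}" "adj u v" by (rule edge_cases)
  \<comment> \<open>the vertices that equal or are joined to no end of another edge of \<open>M\<close>\<close>
  define F where "F = {x. \<forall>e'\<in>M - {e}. \<not> conflict e' {x}}"
  have F: "{x, y} \<subseteq> F \<longleftrightarrow> (\<forall>e'\<in>M - {e}. \<not> conflict e' {x, y})" for x y
    unfolding F_def conflict_def by blast
  have priv: "private_to M e = privates F"
  proof (intro set_eqI iffI)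
    fix f assume f: "f \<in> private_to M e"
    then have "f \<in> edges G" by (simp add: private_to_def)
    then obtain x y where xy: "f = {x, y}" by (rule edge_cases)
    then show "f \<in> privates F" using f F[of x y] by (auto simp: private_to_def)
  next
    fix f assume f: "f \<in> privates F"
    then have fE: "f \<in> edges G" by simp
    then obtain x y where xy: "f = {x, y}" by (rule edge_cases)
    then have "\<forall>e'\<in>M - {e}. \<not> conflict e' f" using f F[of x y] by auto
    moreover have "\<exists>e'\<in>M. conflict e' f" using locally_optimal_covers[OF M fE] .
    ultimately have "\<forall>e'\<in>M. conflict e' f \<longleftrightarrow> e' = e" by (metis Diff_iff singletonD)
    then show "f \<in> private_to M e" using fE by (simp add: private_to_def)
  qed
  have privI: "{x, y} \<in> private_to M e" if "x \<in> F" "y \<in> F" "adj x y" for x y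
    using that priv by (auto simp: adj_def)
  have "\<forall>e'\<in>M. conflict e' e \<longleftrightarrow> e' = e" using e sub ind conflict_refl by (metis subsetD)
  then have "e \<in> private_to M e" using e sub by (simp add: private_to_def subset_iff)
  then have uvF: "u \<in> F" "v \<in> F" using priv uv by auto
  have near: "{f \<in> edges G. conflict e f} = conflicts u v"
    using conflict_near_iff[OF uv(2)] uv(1) by auto
  have "x \<in> near u v \<or> y \<in> near u v" if "x \<in> F" "y \<in> F" "adj x y" for x y
  proof -
    have "conflict e {x, y}" "{x, y} \<in> edges G" using privI[OF that] e by (auto simp: private_to_def)
    then show ?thesis using conflict_near_iff[OF uv(2)] uv(1) by auto
  qed
  moreover have "x = z \<or> x = w \<or> y = z \<or> y = w \<or> adj x z \<or> adj x w \<or> adj y z \<or> adj y w"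
    if "x \<in> F" "y \<in> F" "z \<in> F" "w \<in> F" "adj x y" "adj z w" for x y z w
  proof -
    have "conflict {x, y} {z, w}"
      using locally_optimal_private_conflict[OF M e privI privI] that by blast
    then show ?thesis unfolding conflict_iff by blast
  qed
  ultimately have "exclusive u v F"
    using uv uvF unfolding exclusive_def covered_def by blast
  then show ?thesis using uv(1) priv near by blast
qed

lemma card_edges_le:
  assumes M: "locally_optimal M"
    and b: "\<And>u v F. exclusive u v F \<Longrightarrow> real (card (conflicts u v) + card (privates F)) \<le> \<beta>"
  shows "2 * real (card (edges G)) \<le> \<beta> * real (card M)"
proof -
  have "2 * card (edges G) \<le> (\<Sum>e\<in>M. card {f \<in> edges G. conflict e f} + card (private_to M e))"
    by (rule two_card_edges_le[OF M])
  then have "real (2 * card (edges G)) \<le> real (\<Sum>e\<in>M. card {f \<in> edges G. conflict e f} + card (private_to M e))"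
    by (rule of_nat_mono)
  also have "\<dots> = (\<Sum>e\<in>M. real (card {f \<in> edges G. conflict e f} + card (private_to M e)))"
    by (rule of_nat_sum)
  also have "\<dots> \<le> (\<Sum>e\<in>M. \<beta>)"
  proof (rule sum_mono)
    fix e assume "e \<in> M"
    from exists_exclusive[OF M this]
    obtain u v F where "exclusive u v F" "private_to M e = privates F"
      "{f \<in> edges G. conflict e f} = conflicts u v"
      by (elim exE conjE)
    then show "real (card {f \<in> edges G. conflict e f} + card (private_to M e)) \<le> \<beta>" using b by simp
  qed
  finally show ?thesis by (simp add: mult.commute)
qed

text \<open>
  A bound for a single edge of the matching yields the factor \<open>\<alpha>\<close> by comparing \<open>2|E|\<close> with
  \<open>2 (2d - 1) \<nu>\<^sub>s\<close>.
\<close>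

lemma nu_s_le_card:
  assumes M: "locally_optimal M" and d: "3 \<le> d"
    and b: "\<And>u v F. exclusive u v F \<Longrightarrow>
      real (card (conflicts u v) + card (privates F)) \<le> 2 * (2 * real d - 1) * \<alpha>"
  shows "real (nu_s G) \<le> \<alpha> * real (card M)"
proof -
  have "real (nu_s G * (2 * d - 1)) \<le> real (card (edges G))" by (rule of_nat_mono[OF nu_s_le])
  then have "2 * (real (nu_s G) * (2 * real d - 1)) \<le> 2 * real (card (edges G))"
    using d by (simp add: of_nat_diff)
  also have "\<dots> \<le> 2 * (2 * real d - 1) * \<alpha> * real (card M)"
    by (rule card_edges_le[OF M b])
  finally have "(2 * real d - 1) * real (nu_s G) \<le> (2 * real d - 1) * (\<alpha> * real (card M))"
    by (simp add: algebra_simps)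
  moreover have "0 < 2 * real d - 1" using d by simp
  ultimately show ?thesis by (simp only: mult_le_cancel_left_pos)
qed

end

lemma c4_free_regularI:
  assumes "simple_graph G" "regular d G" "free_of \<F> G" "cycle 4 \<in> \<F>"
  shows "c4_free_regular G d"
proof -
  interpret graph G using assms(1) by unfold_locales
  show ?thesis
    by unfold_locales (use assms(2) induced_C4[OF assms(3,4)] in auto)
qed

lemma approximates_C4_free:
  assumes d: "3 \<le> d"
  shows "local_search_approximates (9 / 16 * real d + 33 / 80)
        {G :: 'a graph. simple_graph G \<and> regular d G \<and> free_of {cycle 4} G}"
  unfolding local_search_approximates_def
proof (intro ballI allI impI)
  fix G :: "'a graph" and M
  assume G: "G \<in> {G. simple_graph G \<and> regular d G \<and> free_of {cycle 4} G}" and M: "local_search_output G M"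
  interpret c4_free_regular G d using G by (intro c4_free_regularI[of _ _ "{cycle 4}"]) auto
  have opt: "locally_optimal M" by (rule local_search_output_locally_optimal[OF M])
  have "real (nu_s G) \<le> (9 / 16 * real d + 33 / 80) * real (card M)"
  proof (rule nu_s_le_card[OF opt d])
    fix u v F assume "exclusive u v F"
    from card_conflicts_privates_C4_free[OF this d]
    have "real (card (conflicts u v) + card (privates F)) \<le> 9 / 4 * real d ^ 2 + 21 / 40 * real d - 33 / 40" .
    also have "\<dots> = 2 * (2 * real d - 1) * (9 / 16 * real d + 33 / 80)"
      by (simp add: field_simps power2_eq_square)
    finally show "real (card (conflicts u v) + card (privates F)) \<le> 2 * (2 * real d - 1) * (9 / 16 * real d + 33 / 80)" .
  qed
  then show "induced_matching G M \<and> real (nu_s G) \<le> (9 / 16 * real d + 33 / 80) * real (card M)"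
    using opt by (simp add: locally_optimal_def)
qed

lemma approximates_C3_C4_free:
  assumes d: "3 \<le> d"
  shows "local_search_approximates (real d / 2 + 1 / 4 + 1 / (8 * real d - 4))
        {G :: 'a graph. simple_graph G \<and> regular d G \<and> free_of {cycle 3, cycle 4} G}"
  unfolding local_search_approximates_def
proof (intro ballI allI impI)
  fix G :: "'a graph" and M
  assume G: "G \<in> {G. simple_graph G \<and> regular d G \<and> free_of {cycle 3, cycle 4} G}" and M: "local_search_output G M"
  interpret c4_free_regular G d using G by (intro c4_free_regularI[of _ _ "{cycle 3, cycle 4}"]) auto
  have opt: "locally_optimal M" by (rule local_search_output_locally_optimal[OF M])
  have C3: "adj a b \<Longrightarrow> adj b c \<Longrightarrow> adj c a \<Longrightarrow> False" for a b c
    using induced_C3[of "{cycle 3, cycle 4}"] G by simp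
  have "real (nu_s G) \<le> (real d / 2 + 1 / 4 + 1 / (8 * real d - 4)) * real (card M)"
  proof (rule nu_s_le_card[OF opt d])
    fix u v F assume "exclusive u v F"
    from of_nat_mono[OF card_conflicts_privates_C3_C4_free[OF this d C3]]
    have "real (card (conflicts u v) + card (privates F)) \<le> 2 * real d * real d" by simp
    moreover have "2 * (2 * real d - 1) * (real d / 2 + 1 / 4 + 1 / (8 * real d - 4)) = 2 * real d * real d"
    proof -
      have "8 * real d - 4 \<noteq> 0" using d by simp
      then show ?thesis by (simp add: field_simps)
    qed
    ultimately show "real (card (conflicts u v) + card (privates F)) \<le>
       2 * (2 * real d - 1) * (real d / 2 + 1 / 4 + 1 / (8 * real d - 4))" by simp
  qed
  then show "induced_matching G M \<and>
      real (nu_s G) \<le> (real d / 2 + 1 / 4 + 1 / (8 * real d - 4)) * real (card M)"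
    using opt by (simp add: locally_optimal_def)
qed

theorem corollary6:
  fixes d :: nat
  assumes "d \<ge> 3"
  shows
    "(local_search_poly_time {G :: 'a graph. simple_graph G} \<and>
      local_search_approximates (9 / 16 * real d + 33 / 80)
        {G :: 'a graph. simple_graph G \<and> regular d G \<and> free_of {cycle 4} G}) \<and>
     (local_search_poly_time {G :: 'a graph. simple_graph G} \<and>
      local_search_approximates (real d / 2 + 1 / 4 + 1 / (8 * real d - 4))
        {G :: 'a graph. simple_graph G \<and> regular d G \<and> free_of {cycle 3, cycle 4} G})"
  using local_search_poly_time_simple approximates_C4_free[OF assms]
    approximates_C3_C4_free[OF assms] by blast

end
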